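(* Let $0<\sigma<1$, $3<\alpha\le 4$, and let $f:(0,1]\times[0,\infty)\to[0,\infty)$ be continuous with $\lim_{t\to0^+}f(t,y)=\infty$ for every $y\in[0,\infty)$, and such that $t^\sigma f(t,y)$ is a continuous function on $[0,1]\times[0,\infty)$. Let $N=\max_{0\le t\le1}\int_0^1G(t,s)s^{-\sigma}\,ds$, where $G$ is the Green function given in the context. Assume that there exist constants $0<\lambda\le\frac1N$ and $\tau>0$ such that for all $x,y\in[0,\infty)$ and $t\in[0,1]$ $$t^\sigma|f(t,x)-f(t,y)|\le\frac{\lambda|x-y|}{\left(1+\tau\sqrt{|x-y|}\right)^2}.$$ Suppose in addition that the function $t^\sigma f(t,y)$ is non-decreasing with respect to the variable $y$. Then the unique non-negative solution $u\in C[0,1]$ of the boundary value problem $$D_{0+}^\alpha u(t)=f(t,u(t)),\quad 0<t<1,\qquad u(0)=u(1)=u'(0)=u'(1)=0,$$ is positive, i.e. $u(t)>0$ for all $t\in(0,1)$.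
   Context: $D_{0+}^\alpha$ is the Riemann–Liouville fractional derivative: for $3<\alpha<4$, $D_{0+}^\alpha u(t)=\frac{1}{\Gamma(4-\alpha)}\frac{d^4}{dt^4}\int_0^t(t-s)^{3-\alpha}u(s)\,ds$, and for $\alpha=4$, $D_{0+}^4u=u^{(4)}$. The Green function $G:[0,1]\times[0,1]\to\mathbb{R}$ is $$G(t,s)=\begin{cases}\dfrac{(t-s)^{\alpha-1}+(1-s)^{\alpha-2}t^{\alpha-2}\left[(s-t)+(\alpha-2)(1-t)s\right]}{\Gamma(\alpha)},&0\le s\le t\le1,\\[2mm]\dfrac{(1-s)^{\alpha-2}t^{\alpha-2}\left[(s-t)+(\alpha-2)(1-t)s\right]}{\Gamma(\alpha)},&0\le t\le s\le1.\end{cases}$$ It is known that $G$ is continuous on $[0,1]\times[0,1]$ and $G(t,s)>0$ for $t,s\in(0,1)$. The maximum defining $N$ exists. "$t^\sigma f(t,y)$ is continuous on $[0,1]\times[0,\infty)$" means that the function $(t,y)\mapsto t^\sigma f(t,y)$, defined for $t\in(0,1]$, extends continuously to $[0,1]\times[0,\infty)$; at $t=0$ expressions involving $t^\sigma f(t,\cdot)$ are understood as values of this extension. A non-negative solution is a function $u\in C[0,1]$ with $u\ge0$ on $[0,1]$, for which $D_{0+}^\alpha u(t)$ exists and equals $f(t,u(t))$ for all $t\in(0,1)$, and which satisfies the boundary conditions ($u'(0)$, $u'(1)$ being one-sided derivatives). Under the hypotheses before "Suppose in addition", such a solution exists and is unique; it is the unique non-negative $u\in C[0,1]$ with $u(t)=\int_0^1G(t,s)f(s,u(s))\,ds$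 for all $t\in[0,1]$. *)

theory Defs
  imports "HOL-Analysis.Analysis"
begin

text \<open>
  \<open>has_nth_deriv n F v t\<close>: the \<open>n\<close>-th derivative of \<open>F\<close> at \<open>t\<close> exists and equals \<open>v\<close>. Iterating
  \<^const>\<open>deriv\<close> would not express existence of the lower order derivatives; here they are
  required to exist in a neighbourhood of \<open>t\<close>.
\<close>

primrec has_nth_deriv :: "nat \<Rightarrow> (real \<Rightarrow> real) \<Rightarrow> real \<Rightarrow> real \<Rightarrow> bool" where
  "has_nth_deriv 0 F v t \<longleftrightarrow> F t = v"
| "has_nth_deriv (Suc n) F v t \<longleftrightarrow>
     (\<exists>F'. (\<forall>\<^sub>F x in nhds t. has_nth_deriv n F (F' x) x) \<and> (F' has_real_derivative v) (at t))"

text \<open>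
  The Riemann--Liouville derivative of order \<open>\<alpha>\<close> of \<open>u\<close> at \<open>t\<close> exists and equals \<open>v\<close>. Only
  meaningful for \<open>3 < \<alpha> \<le> 4\<close>. For \<open>u\<close> continuous on \<open>[0,1]\<close> the integrand is
  absolutely integrable; its value \<open>0\<close> at \<open>s = x\<close> (since \<open>0 powr a = 0\<close>) is immaterial.
\<close>

definition has_RL_deriv :: "real \<Rightarrow> (real \<Rightarrow> real) \<Rightarrow> real \<Rightarrow> real \<Rightarrow> bool" where
  "has_RL_deriv \<alpha> u v t \<longleftrightarrow>
     (if \<alpha> = 4 then has_nth_deriv 4 u v t
      else \<exists>w. has_nth_deriv 4 (\<lambda>x. integral {0..x} (\<lambda>s. (x - s) powr (3 - \<alpha>) * u s)) w t \<and>
               v = 1 / Gamma (4 - \<alpha>) * w)"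

definition green :: "real \<Rightarrow> real \<Rightarrow> real \<Rightarrow> real" where
  "green \<alpha> t s =
     (if s \<le> t
      then ((t - s) powr (\<alpha> - 1)
            + (1 - s) powr (\<alpha> - 2) * t powr (\<alpha> - 2) * ((s - t) + (\<alpha> - 2) * (1 - t) * s))
           / Gamma \<alpha>
      else (1 - s) powr (\<alpha> - 2) * t powr (\<alpha> - 2) * ((s - t) + (\<alpha> - 2) * (1 - t) * s)
           / Gamma \<alpha>)"

text \<open>
  Functions on \<open>[0,1]\<close> are represented by total functions; only the values on \<open>[0,1]\<close> matter.
\<close>

definition nonneg_solution :: "real \<Rightarrow> (real \<Rightarrow> real \<Rightarrow> real) \<Rightarrow> (real \<Rightarrow> real) \<Rightarrow> bool" where
  "nonneg_solution \<alpha> f u \<longleftrightarrow>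
     continuous_on {0..1} u \<and>
     (\<forall>t\<in>{0..1}. 0 \<le> u t) \<and>
     (\<forall>t\<in>{0<..<1}. has_RL_deriv \<alpha> u (f t (u t)) t) \<and>
     u 0 = 0 \<and> u 1 = 0 \<and>
     (u has_real_derivative 0) (at 0 within {0..1}) \<and>
     (u has_real_derivative 0) (at 1 within {0..1})"

end

theory Submission
  imports Defs
begin

text \<open>
  Let \<open>RL a\<close> be the Riemann--Liouville integral of order \<open>a\<close>. Its semigroup law (Fubini and the Beta
  integral) turns \<open>RL (4 - \<alpha>) u\<close> into \<open>RL 4 h\<close> plus a quadratic and a cubic term for
  \<open>u = RL \<alpha> h + A t\<^sup>\<alpha>\<^sup>-\<^sup>2 + B t\<^sup>\<alpha>\<^sup>-\<^sup>1\<close>, so such \<open>u\<close> solve \<open>D\<^sup>\<alpha> u = h\<close>. Conversely, four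
  antidifferentiations determine \<open>RL (4 - \<alpha>) v\<close> up to a cubic polynomial for any solution \<open>v\<close>; the
  conditions at \<open>0\<close> make it \<open>o(t)\<close>, which kills the two lowest coefficients, and applying
  \<open>RL (\<alpha> - 3)\<close> recovers \<open>v\<close>. The conditions at \<open>1\<close> fix \<open>A\<close> and \<open>B\<close>, and the result is integration
  against the Green function. With \<open>h s = f s (u s)\<close> the problem becomes a fixed point equation.

  With \<open>\<psi> d = d / (1 + \<tau> \<surd>d)\<^sup>2\<close> the fixed point operator satisfies
  \<open>\<parallel>\<Phi> u - \<Phi> v\<parallel> \<le> \<psi> \<parallel>u - v\<parallel>\<close>. Since \<open>1 / \<surd>(\<psi> d) = 1 / \<surd>d + \<tau>\<close>, the \<open>n\<close>-th iterate of \<open>\<psi>\<close> is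
  \<open>O(1 / n\<^sup>2)\<close>, hence summable, and Picard iteration converges uniformly.

  The solution is positive because \<open>f s (u s) \<ge> f s 0\<close>, which is positive near \<open>s = 0\<close>, and the Green
  function is positive in the interior by the strict Bernoulli inequality.
\<close>

section \<open>Riemann--Liouville integrals of weakly singular functions\<close>

text \<open>The bound is the one that \<open>s \<mapsto> f s (u s)\<close> inherits from continuity
  of \<open>t powr \<sigma> * f t y\<close> on a compact set; for \<open>\<sigma> < 1\<close> it is
  integrable at \<open>0\<close>. Values outside \<open>(0,1]\<close> are arbitrary, so
  measurability is asked only there.\<close>

definition weakly_singular :: "real \<Rightarrow> (real \<Rightarrow> real) \<Rightarrow> bool" where
  "weakly_singular \<sigma> \<phi> \<longleftrightarrow> set_borel_measurable lborel {0<..1} \<phi> \<and>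
     (\<exists>C. \<forall>s\<in>{0<..1}. \<bar>\<phi> s\<bar> \<le> C * s powr (- \<sigma>))"

text \<open>The open interval leaves out both endpoint singularities of the integrand, and it is
  empty for \<open>t \<le> 0\<close>, where the integral is therefore \<open>0\<close>.\<close>

definition RL :: "real \<Rightarrow> (real \<Rightarrow> real) \<Rightarrow> real \<Rightarrow> real" where
  "RL a \<phi> t = (LINT s:{0<..<t}|lborel. (t - s) powr (a - 1) * \<phi> s) / Gamma a"

section \<open>Beta integrals\<close>

lemma beta_unit:
  fixes a b :: real
  assumes "0 < a" "0 < b"
  shows "has_bochner_integral lborel
           (\<lambda>t. indicator {0<..<1} t *\<^sub>R (t powr (a - 1) * (1 - t) powr (b - 1))) (Beta a b)"
proof (rule has_bochner_integral_nn_integral)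
  have "((\<lambda>t. t powr (a - 1) * (1 - t) powr (b - 1)) has_integral Beta a b) {0<..<1}"
    using has_integral_Beta_real[OF assms] by (simp add: has_integral_Icc_iff_Ioo)
  from nn_integral_has_integral_lebesgue[OF _ this]
  show "(\<integral>\<^sup>+ x. ennreal (indicator {0<..<1} x *\<^sub>R (x powr (a - 1) * (1 - x) powr (b - 1))) \<partial>lborel)
          = ennreal (Beta a b)"
    by simp
qed (use assms in \<open>auto simp: Beta_def less_imp_le Gamma_real_pos\<close>)

text \<open>The affine substitution \<open>t = s + (x - s) * r\<close> reduces the integral to the
  unit interval. The parameters of \<open>Beta\<close> swap on the way, since \<open>1 - r\<close>
  carries the exponent \<open>a - 1\<close>.\<close>

lemma has_bochner_integral_beta_kernel:
  fixes a b s x :: real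
  assumes "0 < a" "0 < b" "s < x"
  shows "has_bochner_integral lborel
           (\<lambda>t. indicator {s<..<x} t *\<^sub>R ((x - t) powr (a - 1) * (t - s) powr (b - 1)))
           (Beta a b * (x - s) powr (a + b - 1))"
proof -
  define d where "d = x - s"
  have d: "d > 0" using assms by (simp add: d_def)
  have "has_bochner_integral lborel
      (\<lambda>t. indicator {0<..<1} (- s / d + (1/d) * t) *\<^sub>R
         ((- s / d + (1/d) * t) powr (b - 1) * (1 - (- s / d + (1/d) * t)) powr (a - 1)))
      (Beta b a /\<^sub>R \<bar>1/d\<bar>)"
    using beta_unit[OF assms(2,1)] d
    by (subst (asm) lborel_has_bochner_integral_real_affine_iff[of "1/d" _ _ "- s / d"]) auto
  \<comment> \<open>The factor \<open>d powr (a + b - 2)\<close> undoes the division of both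
    distances by \<open>d\<close>; the Jacobian supplies one more \<open>d\<close>.\<close>
  from has_bochner_integral_mult_right[OF this, of "d powr (a + b - 2)"]
  have "has_bochner_integral lborel
      (\<lambda>t. d powr (a + b - 2) * (indicator {0<..<1} (- s / d + (1/d) * t) *\<^sub>R
         ((- s / d + (1/d) * t) powr (b - 1) * (1 - (- s / d + (1/d) * t)) powr (a - 1))))
      (d powr (a + b - 2) * (Beta b a /\<^sub>R \<bar>1/d\<bar>))" .
  moreover have "d powr (a + b - 2) * (Beta b a /\<^sub>R \<bar>1/d\<bar>) = Beta a b * d powr (a + b - 1)"
  proof -
    have "d powr (a + b - 1) = d powr (a + b - 2) * d"
      using powr_add[of d "a + b - 2" 1] d by simp
    then show ?thesis using d by (simp add: Beta_commute[of a b] mult_ac)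
  qed
  moreover have "d powr (a + b - 2) * (indicator {0<..<1} (- s / d + (1/d) * t) *\<^sub>R
         ((- s / d + (1/d) * t) powr (b - 1) * (1 - (- s / d + (1/d) * t)) powr (a - 1)))
       = indicator {s<..<x} t *\<^sub>R ((x - t) powr (a - 1) * (t - s) powr (b - 1))" for t
  proof -
    have 1: "- s / d + (1/d) * t = (t - s) / d" using d by (simp add: field_simps)
    have 2: "1 - (t - s) / d = (x - t) / d" using d by (simp add: field_simps d_def)
    have 3: "(t - s) / d \<in> {0<..<1} \<longleftrightarrow> t \<in> {s<..<x}" using d by (auto simp: field_simps d_def)
    have 4: "d powr (a + b - 2) = d powr (a - 1) * d powr (b - 1)" by (simp flip: powr_add)
    show ?thesis unfolding 1 2
      using d 3 by (auto simp: indicator_def powr_divide 4)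
  qed
  ultimately show ?thesis by (simp add: d_def)
qed

lemma set_integral_beta_kernel:
  fixes a b s x :: real
  assumes "0 < a" "0 < b" "s < x"
  shows "set_integrable lborel {s<..<x} (\<lambda>t. (x - t) powr (a - 1) * (t - s) powr (b - 1))"
    and "(LINT t:{s<..<x}|lborel. (x - t) powr (a - 1) * (t - s) powr (b - 1))
           = Beta a b * (x - s) powr (a + b - 1)"
  using has_bochner_integral_beta_kernel[OF assms]
  by (auto simp: set_integrable_def set_lebesgue_integral_def has_bochner_integral_iff)

section \<open>Fractional integrals on the class of weakly singular functions\<close>

lemma weakly_singularI:
  assumes "set_borel_measurable lborel {0<..1} \<phi>"
    and "\<And>s. s \<in> {0<..1} \<Longrightarrow> \<bar>\<phi> s\<bar> \<le> C * s powr (- \<sigma>)"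
  shows "weakly_singular \<sigma> \<phi>"
  using assms unfolding weakly_singular_def by blast

lemma weakly_singular_measurable:
  assumes "weakly_singular \<sigma> \<phi>"
  shows "(\<lambda>s. indicator {0<..1} s * \<phi> s) \<in> borel_measurable borel"
  using assms by (simp add: weakly_singular_def set_borel_measurable_def)

lemma RL_kernel_measurable:
  assumes "weakly_singular \<sigma> \<phi>" "t \<le> 1"
  shows "set_borel_measurable lborel {0<..<t} (\<lambda>s. (t - s) powr c * \<phi> s)"
proof -
  have [measurable]: "(\<lambda>s. indicator {0<..1} s * \<phi> s) \<in> borel_measurable borel"
    by (rule weakly_singular_measurable[OF assms(1)])
  have "(\<lambda>s. indicator {0<..<t} s * ((t - s) powr c * (indicator {0<..1} s * \<phi> s)))
          \<in> borel_measurable borel"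
    by measurable
  also have "(\<lambda>s. indicator {0<..<t} s * ((t - s) powr c * (indicator {0<..1} s * \<phi> s)))
      = (\<lambda>s. indicator {0<..<t} s * ((t - s) powr c * \<phi> s))"
    using assms(2) by (auto simp: indicator_def fun_eq_iff)
  finally show ?thesis by (simp add: set_borel_measurable_def)
qed

text \<open>The integrand is dominated by a multiple of the Beta kernel with the positive parameters
  \<open>a\<close> and \<open>1 - \<sigma>\<close>.\<close>

lemma RL_kernel_integrable:
  assumes "weakly_singular \<sigma> \<phi>" "\<sigma> < 1" "0 < a" "t \<le> 1"
  shows "set_integrable lborel {0<..<t} (\<lambda>s. (t - s) powr (a - 1) * \<phi> s)"
proof (cases "t > 0")
  case True
  obtain C where C: "\<And>s. s \<in> {0<..1} \<Longrightarrow> \<bar>\<phi> s\<bar> \<le> C * s powr (- \<sigma>)"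
    using assms(1) unfolding weakly_singular_def by blast
  have "set_integrable lborel {0<..<t} (\<lambda>s. (t - s) powr (a - 1) * (s - 0) powr ((1 - \<sigma>) - 1))"
    by (rule set_integral_beta_kernel) (use assms True in auto)
  then have "set_integrable lborel {0<..<t} (\<lambda>s. C * ((t - s) powr (a - 1) * s powr (- \<sigma>)))"
    by simp
  then show ?thesis
  proof (rule set_integrable_bound[OF _ RL_kernel_measurable[OF assms(1,4)]], intro AE_I2 impI)
    fix s assume s: "s \<in> {0<..<t}"
    then have "norm ((t - s) powr (a - 1) * \<phi> s) \<le> (t - s) powr (a - 1) * (C * s powr (- \<sigma>))"
      using assms(4) by (auto simp: abs_mult intro!: mult_left_mono C)
    also have "\<dots> \<le> norm (C * ((t - s) powr (a - 1) * s powr (- \<sigma>)))"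
      by (simp add: mult_ac)
    finally show "norm ((t - s) powr (a - 1) * \<phi> s) \<le> norm (C * ((t - s) powr (a - 1) * s powr (- \<sigma>)))" .
  qed
qed (simp add: set_integrable_def)

lemma RL_zero [simp]: "RL a \<phi> 0 = 0"
  by (simp add: RL_def set_lebesgue_integral_def)

lemma weakly_singular_lincomb:
  assumes "weakly_singular \<sigma> \<phi>" "weakly_singular \<sigma> \<psi>"
  shows "weakly_singular \<sigma> (\<lambda>s. c * \<phi> s + d * \<psi> s)"
proof -
  note [measurable] = weakly_singular_measurable[OF assms(1)] weakly_singular_measurable[OF assms(2)]
  obtain C where C: "\<And>s. s \<in> {0<..1} \<Longrightarrow> \<bar>\<phi> s\<bar> \<le> C * s powr (- \<sigma>)"
    using assms(1) unfolding weakly_singular_def by blast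
  obtain D where D: "\<And>s. s \<in> {0<..1} \<Longrightarrow> \<bar>\<psi> s\<bar> \<le> D * s powr (- \<sigma>)"
    using assms(2) unfolding weakly_singular_def by blast
  have "(\<lambda>s. c * (indicator {0<..1} s * \<phi> s) + d * (indicator {0<..1} s * \<psi> s)) \<in> borel_measurable borel"
    by measurable
  then have "(\<lambda>s. indicator {0<..1} s * (c * \<phi> s + d * \<psi> s)) \<in> borel_measurable borel"
    by (simp add: algebra_simps)
  moreover have "\<bar>c * \<phi> s + d * \<psi> s\<bar> \<le> (\<bar>c\<bar> * C + \<bar>d\<bar> * D) * s powr (- \<sigma>)" if "s \<in> {0<..1}" for s
  proof -
    have "\<bar>c * \<phi> s + d * \<psi> s\<bar> \<le> \<bar>c\<bar> * \<bar>\<phi> s\<bar> + \<bar>d\<bar> * \<bar>\<psi> s\<bar>"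
      using abs_triangle_ineq[of "c * \<phi> s" "d * \<psi> s"] by (simp add: abs_mult)
    also have "\<dots> \<le> \<bar>c\<bar> * (C * s powr (- \<sigma>)) + \<bar>d\<bar> * (D * s powr (- \<sigma>))"
      using C[OF that] D[OF that] by (intro add_mono mult_left_mono) auto
    finally show ?thesis by (simp add: algebra_simps)
  qed
  ultimately show ?thesis by (intro weakly_singularI) (auto simp: set_borel_measurable_def)
qed

lemma RL_lincomb:
  assumes "weakly_singular \<sigma> \<phi>" "weakly_singular \<sigma> \<psi>" "\<sigma> < 1" "0 < a" "t \<le> 1"
  shows "RL a (\<lambda>s. c * \<phi> s + d * \<psi> s) t = c * RL a \<phi> t + d * RL a \<psi> t"
proof -
  have "(\<lambda>s. (t - s) powr (a - 1) * (c * \<phi> s + d * \<psi> s)) =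
        (\<lambda>s. c * ((t - s) powr (a - 1) * \<phi> s) + d * ((t - s) powr (a - 1) * \<psi> s))"
    by (simp add: algebra_simps)
  then show ?thesis
    unfolding RL_def
    using RL_kernel_integrable[OF assms(1,3-5)] RL_kernel_integrable[OF assms(2,3-5)]
    by (simp add: set_integral_add set_integral_mult_right add_divide_distrib)
qed

lemma RL_cong:
  assumes "\<And>s. s \<in> {0<..<t} \<Longrightarrow> \<phi> s = \<psi> s"
  shows "RL a \<phi> t = RL a \<psi> t"
  unfolding RL_def by (intro arg_cong2[where f="(/)"] set_lebesgue_integral_cong) (auto simp: assms)

lemma RL_mono:
  assumes "weakly_singular \<sigma> \<phi>" "weakly_singular \<sigma> \<psi>" "\<sigma> < 1" "0 < a" "t \<le> 1"
    and "\<And>s. s \<in> {0<..<t} \<Longrightarrow> \<phi> s \<le> \<psi> s"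
  shows "RL a \<phi> t \<le> RL a \<psi> t"
  unfolding RL_def using assms
  by (intro divide_right_mono set_integral_mono RL_kernel_integrable[of \<sigma>])
     (auto intro!: mult_left_mono simp: less_imp_le Gamma_real_pos)

text \<open>This is the Beta integral with lower endpoint \<open>0\<close>. At \<open>t = 0\<close>
  both sides vanish whatever the exponent, because \<open>0 powr x = 0\<close>.\<close>

lemma RL_powr:
  assumes "0 < a" "0 < b" "0 \<le> t"
  shows "RL a (\<lambda>s. s powr (b - 1)) t = Gamma b / Gamma (a + b) * t powr (a + b - 1)"
proof (cases "t = 0")
  case False
  then show ?thesis
    unfolding RL_def using set_integral_beta_kernel(2)[of a b 0 t] assms Gamma_real_pos[of a]
    by (simp add: Beta_def less_imp_neq[THEN not_sym])
qed simp

lemma weakly_singular_powr: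
  assumes "-\<sigma> \<le> p"
  shows "weakly_singular \<sigma> (\<lambda>s. s powr p)"
  unfolding weakly_singular_def set_borel_measurable_def
  by (auto intro!: exI[of _ 1] powr_mono' assms)

lemma weakly_singular_continuous:
  assumes "continuous_on {0..1} \<phi>" "0 \<le> \<sigma>"
  shows "weakly_singular \<sigma> \<phi>"
proof -
  have "bounded (\<phi> ` {0..1})"
    by (intro compact_imp_bounded compact_continuous_image assms) auto
  then obtain C where "\<forall>y\<in>\<phi> ` {0..1}. norm y \<le> C"
    unfolding bounded_iff by blast
  then have C: "\<bar>\<phi> s\<bar> \<le> C" if "s \<in> {0..1}" for s using that by auto
  have C0: "0 \<le> C" using C[of 0] by auto
  have "\<bar>\<phi> s\<bar> \<le> C * s powr (- \<sigma>)" if "s \<in> {0<..1}" for s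
  proof -
    have "1 \<le> s powr (- \<sigma>)"
      using that assms(2) powr_mono'[of "-\<sigma>" 0 s] by auto
    then have "C * 1 \<le> C * s powr (- \<sigma>)" using C0 by (intro mult_left_mono)
    then show ?thesis using C[of s] that by auto
  qed
  moreover have "set_borel_measurable borel {0<..1} \<phi>"
    unfolding set_borel_measurable_def
    by (rule borel_measurable_continuous_on_indicator) (auto intro: continuous_on_subset[OF assms(1)])
  ultimately show ?thesis by (intro weakly_singularI) (auto simp: set_borel_measurable_def)
qed


lemma weakly_singular_cmult: "weakly_singular \<sigma> \<phi> \<Longrightarrow> weakly_singular \<sigma> (\<lambda>s. c * \<phi> s)"
  using weakly_singular_lincomb[of \<sigma> \<phi> \<phi> c 0] by simp

lemma RL_cmult:
  assumes "weakly_singular \<sigma> \<phi>" "\<sigma> < 1" "0 < a" "t \<le> 1"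
  shows "RL a (\<lambda>s. c * \<phi> s) t = c * RL a \<phi> t"
  using RL_lincomb[of \<sigma> \<phi> \<phi> a t c 0] assms by simp

lemma weakly_singular_abs:
  assumes "weakly_singular \<sigma> \<phi>"
  shows "weakly_singular \<sigma> (\<lambda>s. \<bar>\<phi> s\<bar>)"
proof -
  note [measurable] = weakly_singular_measurable[OF assms(1)]
  have "(\<lambda>s. \<bar>indicator {0<..1} s * \<phi> s\<bar>) \<in> borel_measurable borel"
    by measurable
  then show ?thesis using assms
    by (simp add: weakly_singular_def set_borel_measurable_def abs_mult)
qed

text \<open>Comparison with the powers \<open>C * s powr p\<close> and
  \<open>- C * s powr p\<close>, whose fractional integrals are explicit. It serves to keep
  \<open>RL\<close> inside the weakly singular class and to carry smallness at \<open>0\<close> from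
  a function to its fractional integral.\<close>

lemma RL_bound:
  assumes "weakly_singular \<sigma> \<phi>" "\<sigma> < 1" "0 < a" "0 \<le> t" "t \<le> 1" "-\<sigma> \<le> p"
    and "\<And>s. s \<in> {0<..<t} \<Longrightarrow> \<bar>\<phi> s\<bar> \<le> C * s powr p"
  shows "\<bar>RL a \<phi> t\<bar> \<le> C * (Gamma (p + 1) / Gamma (a + p + 1)) * t powr (a + p)"
proof -
  have w: "weakly_singular \<sigma> (\<lambda>s. s powr p)" using assms by (intro weakly_singular_powr) auto
  have R: "RL a (\<lambda>s. c * s powr p) t = c * (Gamma (p + 1) / Gamma (a + p + 1)) * t powr (a + p)" for c
    using RL_cmult[OF w assms(2,3,5)] RL_powr[of a "p + 1" t] assms by (simp add: add_ac)
  have "RL a \<phi> t \<le> RL a (\<lambda>s. C * s powr p) t"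
    by (rule RL_mono[of \<sigma>]) (use assms(7) in \<open>auto simp: abs_le_iff intro!: assms weakly_singular_cmult w\<close>)
  moreover have "RL a (\<lambda>s. (- C) * s powr p) t \<le> RL a \<phi> t"
    by (rule RL_mono[of \<sigma>, OF weakly_singular_cmult[OF w]]) (use assms in \<open>auto simp: abs_le_iff minus_le_iff\<close>)
  ultimately show ?thesis unfolding R by (simp add: abs_le_iff)
qed

text \<open>Integration improves the bound from \<open>t powr (- \<sigma>)\<close> to
  \<open>t powr (b - \<sigma>)\<close>, which is smaller on \<open>(0,1]\<close>. Hence fractional
  integrals can be iterated within one class.\<close>

lemma weakly_singular_RL:
  assumes "weakly_singular \<sigma> \<phi>" "\<sigma> < 1" "0 < b"
  shows "weakly_singular \<sigma> (RL b \<phi>)"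
proof -
  note [measurable] = weakly_singular_measurable[OF assms(1)]
  \<comment> \<open>Measurability in \<open>t\<close> follows once the integral runs over the whole
    line with a jointly measurable integrand.\<close>
  have "(\<lambda>t. indicator {0<..1} t * ((\<integral>s. (if 0 < s \<and> s < t then (t - s) powr (b - 1) *
     (indicator {0<..1} s * \<phi> s) else 0) \<partial>lborel) / Gamma b)) \<in> borel_measurable borel"
    by measurable
  also have "(\<lambda>t. indicator {0<..1} t * ((\<integral>s. (if 0 < s \<and> s < t then (t - s) powr (b - 1) *
     (indicator {0<..1} s * \<phi> s) else 0) \<partial>lborel) / Gamma b)) = (\<lambda>t. indicator {0<..1} t * RL b \<phi> t)"
  proof
    fix t :: real
    show "indicator {0<..1} t * ((\<integral>s. (if 0 < s \<and> s < t then (t - s) powr (b - 1) *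
     (indicator {0<..1} s * \<phi> s) else 0) \<partial>lborel) / Gamma b) = indicator {0<..1} t * RL b \<phi> t"
    proof (cases "t \<in> {0<..1}")
      case True
      then have "(\<integral>s. (if 0 < s \<and> s < t then (t - s) powr (b - 1) *
         (indicator {0<..1} s * \<phi> s) else 0) \<partial>lborel) =
         (\<integral>s. indicator {0<..<t} s *\<^sub>R ((t - s) powr (b - 1) * \<phi> s) \<partial>lborel)"
        by (intro Bochner_Integration.integral_cong) (auto simp: indicator_def)
      then show ?thesis by (simp add: RL_def set_lebesgue_integral_def)
    qed auto
  qed
  finally have "set_borel_measurable lborel {0<..1} (RL b \<phi>)"
    by (simp add: set_borel_measurable_def)
  moreover obtain C where C: "\<And>s. s \<in> {0<..1} \<Longrightarrow> \<bar>\<phi> s\<bar> \<le> C * s powr (- \<sigma>)"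
    using assms(1) unfolding weakly_singular_def by blast
  define K where "K = C * (Gamma (- \<sigma> + 1) / Gamma (b + - \<sigma> + 1))"
  have "\<bar>RL b \<phi> t\<bar> \<le> K * t powr (- \<sigma>)" if t: "t \<in> {0<..1}" for t
  proof -
    have C0: "0 \<le> C" using C[of 1] by auto
    have "0 \<le> K" unfolding K_def using C0 assms by (intro mult_nonneg_nonneg divide_nonneg_pos) (auto simp: less_imp_le)
    have "\<bar>RL b \<phi> t\<bar> \<le> K * t powr (b + -\<sigma>)" unfolding K_def
      by (rule RL_bound[OF assms]) (use t in \<open>auto intro!: C\<close>)
    also have "\<dots> \<le> K * t powr (- \<sigma>)"
      using t assms \<open>0 \<le> K\<close> by (intro mult_left_mono powr_mono') auto
    finally show ?thesis .
  qed
  ultimately show ?thesis by (rule weakly_singularI)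
qed

text \<open>The double integral runs over the triangle \<open>0 < s < t < x\<close>. With
  \<open>t\<close> integrated first, only the Beta kernel is left inside, and
  \<open>Beta a b\<close> turns the factor \<open>1 / (Gamma a * Gamma b)\<close> into
  \<open>1 / Gamma (a + b)\<close>.\<close>

lemma RL_semigroup:
  assumes "weakly_singular \<sigma> \<phi>" "\<sigma> < 1" "0 < a" "0 < b" "x \<le> 1"
  shows "RL a (RL b \<phi>) x = RL (a + b) \<phi> x"
proof -
  note [measurable] = weakly_singular_measurable[OF assms(1)]
  define F where "F = (\<lambda>t s. if 0 < s \<and> s < t \<and> t < x then (x - t) powr (a - 1) *
     ((t - s) powr (b - 1) * (indicator {0<..1} s * \<phi> s)) else 0)"
  \<comment> \<open>\<open>F1\<close> and \<open>F2\<close> slice the same triangle by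
    \<open>t\<close> and by \<open>s\<close>.\<close>
  have F1: "F t s = indicator {0<..<x} t *\<^sub>R ((x - t) powr (a - 1) *
      (indicator {0<..<t} s *\<^sub>R ((t - s) powr (b - 1) * \<phi> s)))" for t s
    using assms(5) by (auto simp: F_def indicator_def)
  have F2: "F t s = indicator {0<..<x} s *\<^sub>R (\<phi> s *
      (indicator {s<..<x} t *\<^sub>R ((x - t) powr (a - 1) * (t - s) powr (b - 1))))" for t s
    using assms(5) by (auto simp: F_def indicator_def)
  have nF: "\<bar>F t s\<bar> = indicator {0<..<x} t *\<^sub>R ((x - t) powr (a - 1) *
      (indicator {0<..<t} s *\<^sub>R ((t - s) powr (b - 1) * \<bar>\<phi> s\<bar>)))" for t s
    unfolding F1 by (auto simp: indicator_def abs_mult)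
  have Gb: "Gamma b > 0" "Gamma a > 0" "Gamma (a + b) > 0" using assms by auto
  have IF: "integrable (lborel \<Otimes>\<^sub>M lborel) (case_prod F)"
  proof (rule lborel_pair.Fubini_integrable)
    show "case_prod F \<in> borel_measurable (lborel \<Otimes>\<^sub>M lborel)"
      unfolding F_def by measurable
    \<comment> \<open>For fixed \<open>t\<close> the integral of \<open>\<bar>F t s\<bar>\<close> is
      an outer kernel times the fractional integral of \<open>\<bar>\<phi>\<bar>\<close>, which is
      again weakly singular; this gives the absolute integrability that Fubini asks for.\<close>
    have "(\<lambda>t. \<integral>s. norm (case_prod F (t, s)) \<partial>lborel) =
       (\<lambda>t. Gamma b * (indicator {0<..<x} t *\<^sub>R ((x - t) powr (a - 1) * RL b (\<lambda>s. \<bar>\<phi> s\<bar>) t)))"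
      unfolding prod.case real_norm_def nF using Gb
      by (simp add: fun_eq_iff RL_def set_lebesgue_integral_def)
    moreover have "set_integrable lborel {0<..<x} (\<lambda>t. (x - t) powr (a - 1) * RL b (\<lambda>s. \<bar>\<phi> s\<bar>) t)"
      using assms by (intro RL_kernel_integrable[OF weakly_singular_RL[OF weakly_singular_abs]]) auto
    ultimately show "integrable lborel (\<lambda>t. \<integral>s. norm (case_prod F (t, s)) \<partial>lborel)"
      by (auto simp: set_integrable_def)
    have "integrable lborel (\<lambda>s. F t s)" for t
    proof (cases "t \<in> {0<..<x}")
      case True
      then have "set_integrable lborel {0<..<t} (\<lambda>s. (t - s) powr (b - 1) * \<phi> s)"
        using assms by (intro RL_kernel_integrable[OF assms(1)]) auto
      then show ?thesis unfolding F1 by (auto simp: set_integrable_def)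
    qed (simp add: F1)
    then show "AE t in lborel. integrable lborel (\<lambda>s. case_prod F (t, s))" by simp
  qed
  have "Gamma a * Gamma b * RL a (RL b \<phi>) x = (\<integral>t. (\<integral>s. F t s \<partial>lborel) \<partial>lborel)"
    unfolding F1 using Gb by (simp add: RL_def set_lebesgue_integral_def)
  also have "\<dots> = (\<integral>s. (\<integral>t. F t s \<partial>lborel) \<partial>lborel)"
    by (rule lborel_pair.Fubini_integral[OF IF, symmetric])
  also have "\<dots> = (\<integral>s. indicator {0<..<x} s *\<^sub>R (\<phi> s * (Beta a b * (x - s) powr (a + b - 1))) \<partial>lborel)"
  proof (intro Bochner_Integration.integral_cong refl)
    fix s :: real
    show "(\<integral>t. F t s \<partial>lborel) = indicator {0<..<x} s *\<^sub>R (\<phi> s * (Beta a b * (x - s) powr (a + b - 1)))"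
      unfolding F2 using set_integral_beta_kernel(2)[OF assms(3,4), of s x]
      by (cases "s < x") (simp_all add: set_lebesgue_integral_def)
  qed
  also have "\<dots> = Beta a b * (LINT s:{0<..<x}|lborel. (x - s) powr (a + b - 1) * \<phi> s)"
    unfolding set_lebesgue_integral_def
    by (subst integral_mult_right_zero[symmetric]) (simp add: mult_ac)
  also have "\<dots> = Gamma a * Gamma b * RL (a + b) \<phi> x"
    unfolding RL_def Beta_def by simp
  finally show ?thesis using Gb by simp
qed

section \<open>Relation to the gauge integral, continuity and derivatives\<close>

lemma weakly_singular_integrable_on:
  assumes "weakly_singular \<sigma> \<phi>" "\<sigma> < 1" "0 < a" "t \<le> 1"
  shows "(\<lambda>s. (t - s) powr (a - 1) * \<phi> s) integrable_on {0..t}"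
    and "integral {0..t} (\<lambda>s. (t - s) powr (a - 1) * \<phi> s) = Gamma a * RL a \<phi> t"
proof -
  have "Gamma a > 0" using assms by simp
  then show "(\<lambda>s. (t - s) powr (a - 1) * \<phi> s) integrable_on {0..t}"
    and "integral {0..t} (\<lambda>s. (t - s) powr (a - 1) * \<phi> s) = Gamma a * RL a \<phi> t"
    using set_borel_integral_eq_integral[OF RL_kernel_integrable[OF assms]]
    by (auto simp: RL_def integrable_on_Icc_iff_Ioo integral_open_interval_real)
qed

text \<open>The kernel \<open>(t - s) powr 0\<close> is \<open>1\<close> except at
  \<open>s = t\<close>, where \<open>0 powr 0 = 0\<close>; a single point is negligible.\<close>

lemma RL_one:
  assumes "weakly_singular \<sigma> \<phi>" "\<sigma> < 1" "t \<le> 1"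
  shows "\<phi> integrable_on {0..t}" "RL 1 \<phi> t = integral {0..t} \<phi>"
proof -
  have eq: "(t - s) powr (1 - 1) * \<phi> s = \<phi> s" if "s \<in> {0..t} - {t}" for s
    using that by simp
  have n: "negligible {t}" by simp
  show "\<phi> integrable_on {0..t}"
    by (rule integrable_spike[OF weakly_singular_integrable_on(1)[OF assms(1,2), of 1 t] n])
       (use assms eq in auto)
  have "integral {0..t} \<phi> = integral {0..t} (\<lambda>s. (t - s) powr (1 - 1) * \<phi> s)"
    by (rule integral_spike[OF n]) (use eq in auto)
  then show "RL 1 \<phi> t = integral {0..t} \<phi>"
    using weakly_singular_integrable_on(2)[OF assms(1,2), of 1 t] assms(3) by simp
qed

lemma RL_one_has_derivative:
  assumes "weakly_singular \<sigma> \<phi>" "\<sigma> < 1" "t \<in> {0..1}" "continuous (at t within {0..1}) \<phi>"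
  shows "(RL 1 \<phi> has_real_derivative \<phi> t) (at t within {0..1})"
proof -
  have "((\<lambda>u. integral {0..u} \<phi>) has_real_derivative \<phi> t) (at t within {0..1})"
    using integral_has_vector_derivative_continuous_at[OF RL_one(1)[OF assms(1,2)], of 1 t "{}"] assms
    by (simp add: has_real_derivative_iff_has_vector_derivative)
  then show ?thesis
    by (rule has_field_derivative_transform_within[OF _ zero_less_one])
       (use assms RL_one(2)[OF assms(1,2)] in auto)
qed

text \<open>For \<open>b > 1\<close> the semigroup law writes \<open>RL b \<phi>\<close> as the
  indefinite integral of \<open>RL (b - 1) \<phi>\<close>; for \<open>b = 1\<close> it is one
  already.\<close>

lemma RL_continuous_on:
  assumes "weakly_singular \<sigma> \<phi>" "\<sigma> < 1" "1 \<le> b"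
  shows "continuous_on {0..1} (RL b \<phi>)"
proof -
  have *: "continuous_on {0..1} (RL 1 \<psi>)" if "weakly_singular \<sigma> \<psi>" for \<psi>
  proof -
    have "continuous_on {0..1} (\<lambda>t. integral {0..t} \<psi>)"
      by (intro indefinite_integral_continuous_1 RL_one(1)[OF that assms(2)]) simp
    then show ?thesis
      by (rule continuous_on_eq) (use RL_one(2)[OF that assms(2)] in auto)
  qed
  show ?thesis
  proof (cases "b = 1")
    case False
    then have "continuous_on {0..1} (RL 1 (RL (b - 1) \<phi>))"
      using assms by (intro * weakly_singular_RL) auto
    then show ?thesis
      by (rule continuous_on_eq)
         (use False assms RL_semigroup[OF assms(1,2), of 1 "b - 1"] in auto)
  qed (use * assms in auto)
qed

text \<open>\<open>RL (b + 1) \<phi>\<close> is the indefinite integral of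
  \<open>RL b \<phi>\<close>, which is continuous up to the endpoints since
  \<open>b \<ge> 1\<close>. The one-sided derivatives at \<open>0\<close> and \<open>1\<close> are
  thus included.\<close>

lemma RL_has_derivative:
  assumes "weakly_singular \<sigma> \<phi>" "\<sigma> < 1" "1 \<le> b" "t \<in> {0..1}"
  shows "(RL (b + 1) \<phi> has_real_derivative RL b \<phi> t) (at t within {0..1})"
proof -
  have "(RL 1 (RL b \<phi>) has_real_derivative RL b \<phi> t) (at t within {0..1})"
    using assms RL_continuous_on[OF assms(1-3)]
    by (intro RL_one_has_derivative[OF weakly_singular_RL]) (auto simp: continuous_on_eq_continuous_within)
  then show ?thesis
    by (rule has_field_derivative_transform_within[OF _ zero_less_one])
       (use assms RL_semigroup[OF assms(1,2), of 1 b] in \<open>auto simp: add_ac\<close>)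
qed

text \<open>To cover \<open>t = 0\<close> as well, the power is obtained as \<open>p\<close> times
  the indefinite integral of the continuous function \<open>s powr (p - 1)\<close>.\<close>

lemma powr_has_derivative_unit:
  fixes t p :: real
  assumes "1 < p" "t \<in> {0..1}"
  shows "((\<lambda>t. t powr p) has_real_derivative p * t powr (p - 1)) (at t within {0..1})"
proof -
  have c: "continuous_on {0..1} (\<lambda>s::real. s powr (p - 1))"
    using assms by (intro continuous_on_powr') (auto intro!: continuous_intros)
  have "(RL 1 (\<lambda>s. s powr (p - 1)) has_real_derivative t powr (p - 1)) (at t within {0..1})"
    using assms c by (intro RL_one_has_derivative[of 0] weakly_singular_continuous)
      (auto simp: continuous_on_eq_continuous_within)
  from DERIV_cmult[OF this, of p] show ?thesis
  proof (rule has_field_derivative_transform_within[OF _ zero_less_one])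
    fix x :: real assume "x \<in> {0..1}"
    then show "p * RL 1 (\<lambda>s. s powr (p - 1)) x = x powr p"
      using RL_powr[of 1 p x] assms Gamma_plus1[of p] Gamma_real_pos[of p]
      by (cases "p \<in> \<int>\<^sub>\<le>\<^sub>0") (auto simp: add_ac less_imp_neq[THEN not_sym] dest: nonpos_Ints_nonpos)
  qed (use assms in auto)
qed

lemma has_derivative_at_interior:
  fixes F :: "real \<Rightarrow> real"
  assumes "(F has_real_derivative d) (at t within {0..1})" "t \<in> {0<..<1}"
  shows "(F has_real_derivative d) (at t)"
  using assms at_within_Icc_at[of 0 t 1] by auto

section \<open>Iterated derivatives\<close>

lemma has_nth_deriv_unique:
  "has_nth_deriv n F v t \<Longrightarrow> has_nth_deriv n F w t \<Longrightarrow> v = w"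
proof (induction n arbitrary: t v w)
  case (Suc n)
  obtain G where G: "\<forall>\<^sub>F x in nhds t. has_nth_deriv n F (G x) x" "(G has_real_derivative v) (at t)"
    using Suc.prems(1) by auto
  obtain H where H: "\<forall>\<^sub>F x in nhds t. has_nth_deriv n F (H x) x" "(H has_real_derivative w) (at t)"
    using Suc.prems(2) by auto
  have "\<forall>\<^sub>F x in nhds t. H x = G x"
    using G(1) H(1) by eventually_elim (rule Suc.IH)
  then have "(G has_real_derivative w) (at t)"
    using H(2) DERIV_cong_ev[OF refl _ refl] by blast
  then show ?case using G(2) DERIV_unique by blast
qed auto

lemma has_nth_deriv_SucI:
  assumes "open S" "t \<in> S" "\<And>x. x \<in> S \<Longrightarrow> has_nth_deriv n F (F' x) x"
    "(F' has_real_derivative v) (at t)"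
  shows "has_nth_deriv (Suc n) F v t"
proof -
  have "\<forall>\<^sub>F x in nhds t. has_nth_deriv n F (F' x) x"
    using eventually_nhds_in_open[OF assms(1,2)] by eventually_elim (rule assms(3))
  then show ?thesis using assms(4) by auto
qed

text \<open>The definition provides a derivative function near each point separately. Since the
  values of derivatives are unique, these local functions glue to a single one on
  \<open>S\<close>.\<close>

lemma has_nth_deriv_SucD:
  assumes "\<And>t. t \<in> S \<Longrightarrow> has_nth_deriv (Suc n) F (w t) t"
  obtains F' where "\<And>t. t \<in> S \<Longrightarrow> has_nth_deriv n F (F' t) t"
    "\<And>t. t \<in> S \<Longrightarrow> (F' has_real_derivative w t) (at t)"
proof -
  define F' where "F' x = (THE v. has_nth_deriv n F v x)" for x
  have F': "F' x = v" if "has_nth_deriv n F v x" for x v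
    unfolding F'_def using that has_nth_deriv_unique by blast
  have "has_nth_deriv n F (F' t) t \<and> (F' has_real_derivative w t) (at t)" if t: "t \<in> S" for t
  proof -
    obtain G where G: "\<forall>\<^sub>F x in nhds t. has_nth_deriv n F (G x) x" "(G has_real_derivative w t) (at t)"
      using assms[OF t] by auto
    have "\<forall>\<^sub>F x in nhds t. F' x = G x" using G(1) by eventually_elim (rule F')
    then have "(F' has_real_derivative w t) (at t)"
      using G(2) DERIV_cong_ev[OF refl _ refl] by blast
    moreover have "has_nth_deriv n F (G t) t" using G(1) by (rule eventually_nhds_x_imp_x)
    ultimately show ?thesis using F' by auto
  qed
  then show thesis using that by blast
qed

text \<open>Lowers the order by one: two functions with the same derivative on a convex set differ
  by a constant.\<close>

lemma has_nth_deriv_antiderivative: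
  assumes "\<And>t. t \<in> S \<Longrightarrow> has_nth_deriv (Suc n) F (w t) t" "convex S"
    and "\<And>t. t \<in> S \<Longrightarrow> (P has_real_derivative w t) (at t)"
  obtains c where "\<And>t. t \<in> S \<Longrightarrow> has_nth_deriv n F (P t + c) t"
proof -
  obtain F' where F': "\<And>t. t \<in> S \<Longrightarrow> has_nth_deriv n F (F' t) t"
    "\<And>t. t \<in> S \<Longrightarrow> (F' has_real_derivative w t) (at t)"
    using has_nth_deriv_SucD[OF assms(1)] by blast
  have "((\<lambda>t. F' t - P t) has_real_derivative 0) (at t within S)" if "t \<in> S" for t
    using DERIV_diff[OF F'(2)[OF that] assms(3)[OF that]]
    by (auto intro: has_field_derivative_at_within)
  from has_field_derivative_zero_constant[OF assms(2) this]
  obtain c where "\<And>t. t \<in> S \<Longrightarrow> F' t - P t = c" by blast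
  then have "F' t = P t + c" if "t \<in> S" for t using that by (metis add.commute diff_add_cancel)
  then show thesis using F'(1) that by metis
qed

lemma RL_nat_derivs:
  assumes "weakly_singular \<sigma> h" "\<sigma> < 1" "continuous_on {0<..<1} h" "t \<in> {0<..<1}"
  shows "(RL 1 h has_real_derivative h t) (at t)"
    and "(RL 2 h has_real_derivative RL 1 h t) (at t)"
    and "(RL 3 h has_real_derivative RL 2 h t) (at t)"
    and "(RL 4 h has_real_derivative RL 3 h t) (at t)"
proof -
  have "continuous (at t within {0..1}) h"
    using assms(3,4) by (simp add: continuous_on_eq_continuous_at continuous_at_imp_continuous_at_within)
  then show "(RL 1 h has_real_derivative h t) (at t)"
    using RL_one_has_derivative[OF assms(1,2)] assms(4) by (intro has_derivative_at_interior) auto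
  have "(RL (b + 1) h has_real_derivative RL b h t) (at t)" if "1 \<le> b" for b
    using RL_has_derivative[OF assms(1,2) that] assms(4) by (intro has_derivative_at_interior) auto
  from this[of 1] this[of 2] this[of 3]
  show "(RL 2 h has_real_derivative RL 1 h t) (at t)"
    "(RL 3 h has_real_derivative RL 2 h t) (at t)"
    "(RL 4 h has_real_derivative RL 3 h t) (at t)" by simp_all
qed

text \<open>The factor \<open>c\<close> serves both cases of the fractional derivative: it is
  \<open>1\<close> for \<open>\<alpha> = 4\<close> and \<open>Gamma (4 - \<alpha>)\<close>
  otherwise. Four differentiations remove the quadratic and the cubic term.\<close>

lemma has_4th_deriv_RL:
  assumes h: "weakly_singular \<sigma> h" "\<sigma> < 1" "continuous_on {0<..<1} h" and t: "t \<in> {0<..<1}"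
    and F: "\<And>x. x \<in> {0<..<1} \<Longrightarrow> F x = c * RL 4 h x + A * x ^ 2 + B * x ^ 3"
  shows "has_nth_deriv 4 F (c * h t) t"
proof -
  note D = RL_nat_derivs[OF h, THEN DERIV_cong]
  let ?S = "{0<..<1::real}"
  have 0: "has_nth_deriv 0 F (c * RL 4 h x + A * x ^ 2 + B * x ^ 3) x" if "x \<in> ?S" for x
    using F[OF that] by simp
  have 1: "has_nth_deriv (Suc 0) F (c * RL 3 h x + 2 * A * x + 3 * B * x ^ 2) x" if "x \<in> ?S" for x
    by (rule has_nth_deriv_SucI[OF _ that 0])
       (use that in \<open>auto intro!: derivative_eq_intros D simp: power2_eq_square\<close>)
  have 2: "has_nth_deriv (Suc (Suc 0)) F (c * RL 2 h x + 2 * A + 6 * B * x) x" if "x \<in> ?S" for x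
    by (rule has_nth_deriv_SucI[OF _ that 1])
       (use that in \<open>auto intro!: derivative_eq_intros D simp: power2_eq_square\<close>)
  have 3: "has_nth_deriv (Suc (Suc (Suc 0))) F (c * RL 1 h x + 6 * B) x" if "x \<in> ?S" for x
    by (rule has_nth_deriv_SucI[OF _ that 2])
       (use that in \<open>auto intro!: derivative_eq_intros D simp: power2_eq_square\<close>)
  have "has_nth_deriv (Suc (Suc (Suc (Suc 0)))) F (c * h t) t"
    by (rule has_nth_deriv_SucI[OF _ t 3])
       (use t in \<open>auto intro!: derivative_eq_intros D simp: power2_eq_square\<close>)
  then show ?thesis by (simp only: eval_nat_numeral BitM.simps)
qed

text \<open>Each of the four antidifferentiations contributes one constant, and together they form
  the cubic polynomial.\<close>

lemma has_4th_deriv_RLD: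
  assumes h: "weakly_singular \<sigma> h" "\<sigma> < 1" "continuous_on {0<..<1} h"
    and F: "\<And>t. t \<in> {0<..<1} \<Longrightarrow> has_nth_deriv 4 F (c * h t) t"
  obtains c0 c1 c2 c3 where
    "\<And>t. t \<in> {0<..<1} \<Longrightarrow> F t = c * RL 4 h t + (c0 + c1 * t + c2 * t ^ 2 + c3 * t ^ 3)"
proof -
  note D = RL_nat_derivs[OF h, THEN DERIV_cong]
  let ?S = "{0<..<1::real}"
  have cv: "convex ?S" by simp
  have 4: "has_nth_deriv (Suc 3) F (c * h t) t" if "t \<in> ?S" for t
    using F[OF that] by (simp add: eval_nat_numeral)
  obtain a where 3: "\<And>t. t \<in> ?S \<Longrightarrow> has_nth_deriv 3 F (c * RL 1 h t + a) t"
    by (rule has_nth_deriv_antiderivative[OF 4 cv, of "\<lambda>t. c * RL 1 h t"])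
       (auto intro!: derivative_eq_intros D)
  then have 3: "has_nth_deriv (Suc 2) F (c * RL 1 h t + a) t" if "t \<in> ?S" for t
    using that by (simp add: eval_nat_numeral)
  obtain b where 2: "\<And>t. t \<in> ?S \<Longrightarrow> has_nth_deriv 2 F (c * RL 2 h t + a * t + b) t"
    by (rule has_nth_deriv_antiderivative[OF 3 cv, of "\<lambda>t. c * RL 2 h t + a * t"])
       (auto intro!: derivative_eq_intros D)
  then have 2: "has_nth_deriv (Suc 1) F (c * RL 2 h t + a * t + b) t" if "t \<in> ?S" for t
    using that by (simp add: eval_nat_numeral)
  obtain d where 1: "\<And>t. t \<in> ?S \<Longrightarrow> has_nth_deriv 1 F (c * RL 3 h t + a / 2 * t ^ 2 + b * t + d) t"
    by (rule has_nth_deriv_antiderivative[OF 2 cv, of "\<lambda>t. c * RL 3 h t + a / 2 * t ^ 2 + b * t"])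
       (auto intro!: derivative_eq_intros D)
  then have 1: "has_nth_deriv (Suc 0) F (c * RL 3 h t + a / 2 * t ^ 2 + b * t + d) t" if "t \<in> ?S" for t
    using that by (simp add: eval_nat_numeral)
  obtain e where 0: "\<And>t. t \<in> ?S \<Longrightarrow> has_nth_deriv 0 F (c * RL 4 h t + a / 6 * t ^ 3 + b / 2 * t ^ 2 + d * t + e) t"
    by (rule has_nth_deriv_antiderivative[OF 1 cv, of "\<lambda>t. c * RL 4 h t + a / 6 * t ^ 3 + b / 2 * t ^ 2 + d * t"])
       (auto intro!: derivative_eq_intros D)
  show thesis
    by (rule that[of e d "b / 2" "a / 6"]) (use 0 in simp)
qed

section \<open>The linear boundary value problem\<close>

text \<open>A particular solution plus those homogeneous solutions that are compatible with the
  conditions at \<open>0\<close>; the powers \<open>\<alpha> - 3\<close> and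
  \<open>\<alpha> - 4\<close> are excluded by them.\<close>

definition pre_sol :: "real \<Rightarrow> (real \<Rightarrow> real) \<Rightarrow> real \<Rightarrow> real \<Rightarrow> real \<Rightarrow> real" where
  "pre_sol \<alpha> h A B t = RL \<alpha> h t + A * t powr (\<alpha> - 2) + B * t powr (\<alpha> - 1)"

text \<open>The coefficients solve the linear system that the conditions at \<open>1\<close> impose:
  \<open>RL \<alpha> h 1 + A + B = 0\<close> and \<open>RL (\<alpha> - 1) h 1 + (\<alpha> - 2) * A +
  (\<alpha> - 1) * B = 0\<close>.\<close>

definition bvp_sol :: "real \<Rightarrow> (real \<Rightarrow> real) \<Rightarrow> real \<Rightarrow> real" where
  "bvp_sol \<alpha> h = pre_sol \<alpha> h (RL (\<alpha> - 1) h 1 - (\<alpha> - 1) * RL \<alpha> h 1)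
                          ((\<alpha> - 2) * RL \<alpha> h 1 - RL (\<alpha> - 1) h 1)"

lemma pre_sol_has_derivative:
  assumes h: "weakly_singular \<sigma> h" "\<sigma> < 1" and \<alpha>: "3 < \<alpha>" and t: "t \<in> {0..1}"
  shows "(pre_sol \<alpha> h A B has_real_derivative
           RL (\<alpha> - 1) h t + A * ((\<alpha> - 2) * t powr (\<alpha> - 3)) + B * ((\<alpha> - 1) * t powr (\<alpha> - 2)))
         (at t within {0..1})"
proof -
  have "(RL (\<alpha> - 1 + 1) h has_real_derivative RL (\<alpha> - 1) h t) (at t within {0..1})"
    by (rule RL_has_derivative[OF h]) (use \<alpha> t in auto)
  moreover have "((\<lambda>t. t powr (\<alpha> - 2)) has_real_derivative (\<alpha> - 2) * t powr (\<alpha> - 3)) (at t within {0..1})"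
    "((\<lambda>t. t powr (\<alpha> - 1)) has_real_derivative (\<alpha> - 1) * t powr (\<alpha> - 2)) (at t within {0..1})"
    using powr_has_derivative_unit[of "\<alpha> - 2" t] powr_has_derivative_unit[of "\<alpha> - 1" t] \<alpha> t
    by simp_all
  ultimately show ?thesis
    unfolding pre_sol_def[abs_def] by (intro DERIV_add DERIV_cmult) simp_all
qed

lemma pre_sol_continuous_on:
  assumes "weakly_singular \<sigma> h" "\<sigma> < 1" "3 < \<alpha>"
  shows "continuous_on {0..1} (pre_sol \<alpha> h A B)"
  using pre_sol_has_derivative[OF assms] by (intro DERIV_continuous_on)

text \<open>The orders \<open>4 - \<alpha>\<close> and \<open>\<alpha>\<close> add up to
  \<open>4\<close>, and the two powers become \<open>x ^ 2\<close> and \<open>x ^ 3\<close>; the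
  denominators are \<open>Gamma 3 = 2\<close> and \<open>Gamma 4 = 6\<close>.\<close>

lemma RL_pre_sol:
  assumes h: "weakly_singular \<sigma> h" "0 \<le> \<sigma>" "\<sigma> < 1" and \<alpha>: "3 < \<alpha>" "\<alpha> < 4" and x: "x \<in> {0..1}"
  shows "RL (4 - \<alpha>) (pre_sol \<alpha> h A B) x =
    RL 4 h x + A * (Gamma (\<alpha> - 1) / 2) * x ^ 2 + B * (Gamma \<alpha> / 6) * x ^ 3"
proof -
  have w: "weakly_singular \<sigma> (RL \<alpha> h)" "weakly_singular \<sigma> (\<lambda>t. t powr (\<alpha> - 2))" "weakly_singular \<sigma> (\<lambda>t. t powr (\<alpha> - 1))"
    using h \<alpha> by (auto intro!: weakly_singular_RL weakly_singular_powr)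
  have "RL (4 - \<alpha>) (pre_sol \<alpha> h A B) x
      = RL (4 - \<alpha>) (\<lambda>t. 1 * RL \<alpha> h t + A * t powr (\<alpha> - 2)) x + B * RL (4 - \<alpha>) (\<lambda>t. t powr (\<alpha> - 1)) x"
    using RL_lincomb[OF weakly_singular_lincomb[OF w(1,2), of 1 A] w(3) h(3), of "4 - \<alpha>" x 1 B] \<alpha> x
    by (simp add: pre_sol_def[abs_def])
  also have "RL (4 - \<alpha>) (\<lambda>t. 1 * RL \<alpha> h t + A * t powr (\<alpha> - 2)) x
      = 1 * RL (4 - \<alpha>) (RL \<alpha> h) x + A * RL (4 - \<alpha>) (\<lambda>t. t powr (\<alpha> - 2)) x"
    using \<alpha> x by (intro RL_lincomb[OF w(1,2) h(3)]) auto
  also have "RL (4 - \<alpha>) (RL \<alpha> h) x = RL 4 h x"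
    using RL_semigroup[OF h(1,3), of "4 - \<alpha>" \<alpha> x] \<alpha> x by simp
  also have "RL (4 - \<alpha>) (\<lambda>t. t powr (\<alpha> - 2)) x = Gamma (\<alpha> - 1) / 2 * x ^ 2"
    using RL_powr[of "4 - \<alpha>" "\<alpha> - 1" x] \<alpha> x Gamma_fact[of 2, where 'a=real] by (simp add: fact_numeral)
  also have "RL (4 - \<alpha>) (\<lambda>t. t powr (\<alpha> - 1)) x = Gamma \<alpha> / 6 * x ^ 3"
    using RL_powr[of "4 - \<alpha>" \<alpha> x] \<alpha> x Gamma_fact[of 3, where 'a=real] by (simp add: fact_numeral)
  finally show ?thesis by simp
qed

lemma bvp_sol_boundary:
  assumes h: "weakly_singular \<sigma> h" "\<sigma> < 1" and \<alpha>: "3 < \<alpha>"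
  shows "bvp_sol \<alpha> h 0 = 0" "bvp_sol \<alpha> h 1 = 0"
    "(bvp_sol \<alpha> h has_real_derivative 0) (at 0 within {0..1})"
    "(bvp_sol \<alpha> h has_real_derivative 0) (at 1 within {0..1})"
proof -
  show "bvp_sol \<alpha> h 0 = 0" "bvp_sol \<alpha> h 1 = 0"
    using \<alpha> by (simp_all add: bvp_sol_def pre_sol_def algebra_simps)
  show "(bvp_sol \<alpha> h has_real_derivative 0) (at 0 within {0..1})"
    "(bvp_sol \<alpha> h has_real_derivative 0) (at 1 within {0..1})"
    unfolding bvp_sol_def using \<alpha>
    by (auto intro!: DERIV_cong[OF pre_sol_has_derivative[OF h \<alpha>]] simp: algebra_simps)
qed

text \<open>Agreement of \<open>u\<close> with \<open>bvp_sol \<alpha> h\<close> on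
  \<open>[0,1]\<close> is enough, since derivatives are taken at interior points and the fractional
  integral only sees \<open>[0,x]\<close>.\<close>

lemma bvp_sol_has_RL_deriv:
  assumes h: "weakly_singular \<sigma> h" "0 \<le> \<sigma>" "\<sigma> < 1" "continuous_on {0<..<1} h"
    and \<alpha>: "3 < \<alpha>" "\<alpha> \<le> 4" and t: "t \<in> {0<..<1}"
    and u: "\<And>t. t \<in> {0..1} \<Longrightarrow> u t = bvp_sol \<alpha> h t"
  shows "has_RL_deriv \<alpha> u (h t) t"
proof (cases "\<alpha> = 4")
  case True
  have "has_nth_deriv 4 u (1 * h t) t"
    by (rule has_4th_deriv_RL[OF h(1,3,4) t, of _ _ "RL 3 h 1 - 3 * RL 4 h 1" "2 * RL 4 h 1 - RL 3 h 1"])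
       (use u True in \<open>auto simp: bvp_sol_def pre_sol_def powr_numeral\<close>)
  then show ?thesis using True by (simp add: has_RL_deriv_def)
next
  case False
  define A where "A = RL (\<alpha> - 1) h 1 - (\<alpha> - 1) * RL \<alpha> h 1"
  define B where "B = (\<alpha> - 2) * RL \<alpha> h 1 - RL (\<alpha> - 1) h 1"
  have AB: "bvp_sol \<alpha> h = pre_sol \<alpha> h A B" by (simp add: bvp_sol_def A_def B_def)
  have \<alpha>': "\<alpha> < 4" "0 < 4 - \<alpha>" using \<alpha> False by auto
  have G: "Gamma (4 - \<alpha>) > 0" using \<alpha>' by simp
  have w: "weakly_singular \<sigma> (bvp_sol \<alpha> h)"
    unfolding bvp_sol_def by (intro weakly_singular_continuous pre_sol_continuous_on[OF h(1,3) \<alpha>(1)] h)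
  have "has_nth_deriv 4 (\<lambda>x. integral {0..x} (\<lambda>s. (x - s) powr (3 - \<alpha>) * u s)) (Gamma (4 - \<alpha>) * h t) t"
  proof (rule has_4th_deriv_RL[OF h(1,3,4) t])
    fix x :: real assume x: "x \<in> {0<..<1}"
    have "integral {0..x} (\<lambda>s. (x - s) powr (3 - \<alpha>) * u s) =
        integral {0..x} (\<lambda>s. (x - s) powr ((4 - \<alpha>) - 1) * bvp_sol \<alpha> h s)"
      using x u by (intro integral_cong) auto
    also have "\<dots> = Gamma (4 - \<alpha>) * RL (4 - \<alpha>) (bvp_sol \<alpha> h) x"
      using weakly_singular_integrable_on(2)[OF w h(3) \<alpha>'(2), of x] x by simp
    also have "\<dots> = Gamma (4 - \<alpha>) * RL 4 h x + Gamma (4 - \<alpha>) * (A * (Gamma (\<alpha> - 1) / 2)) * x ^ 2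
         + Gamma (4 - \<alpha>) * (B * (Gamma \<alpha> / 6)) * x ^ 3"
      using x RL_pre_sol[OF h(1-3) \<alpha>(1) \<alpha>'(1), of x]
      by (simp add: AB algebra_simps)
    finally show "integral {0..x} (\<lambda>s. (x - s) powr (3 - \<alpha>) * u s) = \<dots>" .
  qed
  then show ?thesis using False G unfolding has_RL_deriv_def by auto
qed

section \<open>Uniqueness for the linear problem\<close>

lemma tendsto_div_zero_of_derivative:
  fixes F :: "real \<Rightarrow> real"
  assumes "(F has_real_derivative 0) (at 0 within {0..1})" "F 0 = 0"
  shows "((\<lambda>t. F t / t) \<longlongrightarrow> 0) (at_right 0)"
  using assms by (simp add: has_field_derivative_iff at_within_Icc_at_right)

text \<open>If \<open>\<bar>v s\<bar> \<le> e' * s\<close> near \<open>0\<close>, then the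
  fractional integral is at most \<open>e' * K * t powr (a + 1)\<close>, hence at most
  \<open>e' * K * t\<close> for \<open>t \<le> 1\<close>.\<close>

lemma RL_tendsto_div_zero:
  assumes v: "weakly_singular \<sigma> v" "0 \<le> \<sigma>" "\<sigma> < 1" "0 < a"
    and lim: "((\<lambda>t. v t / t) \<longlongrightarrow> 0) (at_right 0)"
  shows "((\<lambda>t. RL a v t / t) \<longlongrightarrow> 0) (at_right 0)"
proof (rule tendstoI)
  fix e :: real assume e: "0 < e"
  \<comment> \<open>The constant of \<open>RL_bound\<close> for \<open>p = 1\<close>. The factor
    \<open>2\<close> in \<open>e'\<close> makes the final inequality strict.\<close>
  define K where "K = Gamma (1 + 1) / Gamma (a + 1 + 1)"
  have K: "K > 0" unfolding K_def using v(4) by (intro divide_pos_pos Gamma_real_pos) auto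
  define e' where "e' = e / (2 * K)"
  have e': "e' > 0" using e K by (simp add: e'_def)
  from tendstoD[OF lim e'] obtain d where d: "d > 0" "\<And>s. 0 < s \<Longrightarrow> s < d \<Longrightarrow> \<bar>v s / s\<bar> < e'"
    unfolding eventually_at_right_field by auto
  have "dist (RL a v t / t) 0 < e" if t: "0 < t" "t < min d 1" for t
  proof -
    have "\<bar>RL a v t\<bar> \<le> e' * K * t powr (a + 1)" unfolding K_def
    proof (rule RL_bound[OF v(1,3,4)])
      fix s assume s: "s \<in> {0<..<t}"
      then have "\<bar>v s\<bar> / s < e'" using d(2)[of s] t by simp
      then show "\<bar>v s\<bar> \<le> e' * s powr 1" using s by (simp add: field_simps)
    qed (use t v in auto)
    also have "\<dots> \<le> e' * K * t powr 1"
      using t v(4) K e' by (intro mult_left_mono powr_mono') auto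
    finally have "\<bar>RL a v t\<bar> / t \<le> e' * K" using t by (simp add: field_simps)
    also have "\<dots> < e" using e K by (simp add: e'_def)
    finally show ?thesis using t by simp
  qed
  then show "\<forall>\<^sub>F t in at_right 0. dist (RL a v t / t) 0 < e"
    unfolding eventually_at_right_field using d(1) by (intro exI[of _ "min d 1"]) auto
qed

lemma poly_coeffs_zero:
  fixes c0 c1 c2 c3 :: real
  assumes "((\<lambda>t. (c0 + c1 * t + c2 * t ^ 2 + c3 * t ^ 3) / t) \<longlongrightarrow> 0) (at_right 0)"
  shows "c0 = 0" "c1 = 0"
proof -
  let ?p = "\<lambda>t. c0 + c1 * t + c2 * t ^ 2 + c3 * t ^ 3"
  have pos: "\<forall>\<^sub>F t in at_right 0. (0::real) < t" by (rule eventually_at_right_less)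
  have nb: "at_right (0::real) \<noteq> bot" by simp
  have "((\<lambda>t. ?p t / t * t) \<longlongrightarrow> 0 * 0) (at_right 0)"
    by (intro tendsto_mult assms tendsto_ident_at)
  moreover have "\<forall>\<^sub>F t in at_right 0. ?p t / t * t = ?p t"
    using pos by eventually_elim simp
  ultimately have "(?p \<longlongrightarrow> 0 * 0) (at_right 0)"
    by (rule Lim_transform_eventually)
  moreover have "(?p \<longlongrightarrow> c0 + c1 * 0 + c2 * 0 ^ 2 + c3 * 0 ^ 3) (at_right 0)"
    by (intro tendsto_intros)
  ultimately show c0: "c0 = 0" using tendsto_unique[OF nb] by fastforce
  have "\<forall>\<^sub>F t in at_right 0. ?p t / t = c1 + c2 * t + c3 * t ^ 2"
    using pos by eventually_elim (simp add: c0 field_simps power2_eq_square power3_eq_cube)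
  from Lim_transform_eventually[OF assms this]
  have "((\<lambda>t. c1 + c2 * t + c3 * t ^ 2) \<longlongrightarrow> 0) (at_right 0)" .
  moreover have "((\<lambda>t. c1 + c2 * t + c3 * t ^ 2) \<longlongrightarrow> c1 + c2 * 0 + c3 * 0 ^ 2) (at_right 0)"
    by (intro tendsto_intros)
  ultimately show "c1 = 0" using tendsto_unique[OF nb] by fastforce
qed

text \<open>Inversion of Abel's integral equation: applying \<open>RL (1 - a)\<close> raises the
  order to \<open>1\<close>, and differentiating the resulting indefinite integrals returns
  \<open>v\<close> and \<open>w\<close>.\<close>

lemma RL_inj:
  assumes v: "continuous_on {0..1} v" and w: "continuous_on {0..1} w"
    and a: "0 < a" "a < 1"
    and eq: "\<And>t. t \<in> {0<..<1} \<Longrightarrow> RL a v t = RL a w t"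
    and t: "t \<in> {0<..<1}"
  shows "v t = w t"
proof -
  have vw: "weakly_singular 0 v" "weakly_singular 0 w" using v w by (auto intro: weakly_singular_continuous)
  have 1: "RL 1 v x = RL 1 w x" if x: "x \<in> {0<..<1}" for x
  proof -
    have "RL 1 v x = RL (1 - a) (RL a v) x"
      using RL_semigroup[OF vw(1), of "1 - a" a x] a x by simp
    also have "\<dots> = RL (1 - a) (RL a w) x"
      by (rule RL_cong) (use x in \<open>auto intro: eq\<close>)
    also have "\<dots> = RL 1 w x"
      using RL_semigroup[OF vw(2), of "1 - a" a x] a x by simp
    finally show ?thesis .
  qed
  have "(RL 1 v has_real_derivative v t) (at t)" "(RL 1 w has_real_derivative w t) (at t)"
    using v w t by (auto intro!: has_derivative_at_interior RL_one_has_derivative vw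
        simp: continuous_on_eq_continuous_within)
  moreover have "\<forall>\<^sub>F x in nhds t. RL 1 v x = RL 1 w x"
    using eventually_nhds_in_open[OF _ t] by (auto elim!: eventually_mono intro: 1)
  ultimately show ?thesis using DERIV_cong_ev[OF refl _ refl] DERIV_unique by blast
qed

lemma pre_sol_of_RL_deriv:
  assumes h: "weakly_singular \<sigma> h" "0 \<le> \<sigma>" "\<sigma> < 1" "continuous_on {0<..<1} h"
    and \<alpha>: "3 < \<alpha>" "\<alpha> \<le> 4" and v: "continuous_on {0..1} v"
    and D: "\<And>t. t \<in> {0<..<1} \<Longrightarrow> has_RL_deriv \<alpha> v (h t) t"
    and v0: "v 0 = 0" "(v has_real_derivative 0) (at 0 within {0..1})"
  obtains A B where "\<And>t. t \<in> {0..1} \<Longrightarrow> v t = pre_sol \<alpha> h A B t"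
proof -
  have vlim: "((\<lambda>t. v t / t) \<longlongrightarrow> 0) (at_right 0)"
    using tendsto_div_zero_of_derivative v0 by blast
  have Rlim: "((\<lambda>t. RL 4 h t / t) \<longlongrightarrow> 0) (at_right 0)"
    using RL_has_derivative[OF h(1,3), of 3 0] by (intro tendsto_div_zero_of_derivative) auto
  \<comment> \<open>Common to both cases: \<open>F\<close> is \<open>v\<close> itself when
    \<open>\<alpha> = 4\<close> and the unnormalised fractional integral \<open>J\<close> otherwise.
    Being \<open>o(t)\<close> at \<open>0\<close>, it has no constant or linear term.\<close>
  have cubic: "\<exists>c2 c3. \<forall>t\<in>{0<..<1}. F t = c * RL 4 h t + (c2 * t ^ 2 + c3 * t ^ 3)"
    if F: "\<And>t. t \<in> {0<..<1} \<Longrightarrow> has_nth_deriv 4 F (c * h t) t"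
      and Flim: "((\<lambda>t. F t / t) \<longlongrightarrow> 0) (at_right 0)" for F c
  proof -
    obtain c0 c1 c2 c3 where
      c: "\<And>t. t \<in> {0<..<1} \<Longrightarrow> F t = c * RL 4 h t + (c0 + c1 * t + c2 * t ^ 2 + c3 * t ^ 3)"
      using has_4th_deriv_RLD[OF h(1,3,4) F] by blast
    have "((\<lambda>t. F t / t - c * (RL 4 h t / t)) \<longlongrightarrow> 0 - c * 0) (at_right 0)"
      by (intro tendsto_intros Flim Rlim)
    moreover have "\<forall>\<^sub>F t in at_right 0. F t / t - c * (RL 4 h t / t) = (c0 + c1 * t + c2 * t ^ 2 + c3 * t ^ 3) / t"
      unfolding eventually_at_right_field
      by (intro exI[of _ 1]) (auto simp: c diff_divide_distrib[symmetric])
    ultimately have "((\<lambda>t. (c0 + c1 * t + c2 * t ^ 2 + c3 * t ^ 3) / t) \<longlongrightarrow> 0 - c * 0) (at_right 0)"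
      by (rule Lim_transform_eventually)
    then have "c0 = 0" "c1 = 0" using poly_coeffs_zero[of c0 c1 c2 c3] by auto
    then show ?thesis using c by auto
  qed
  have "\<exists>A B. \<forall>t\<in>{0<..<1}. v t = pre_sol \<alpha> h A B t"
  proof (cases "\<alpha> = 4")
    case True
    have "has_nth_deriv 4 v (1 * h t) t" if "t \<in> {0<..<1}" for t
      using D[OF that] True by (simp add: has_RL_deriv_def)
    from cubic[OF this vlim] show ?thesis
      using True by (fastforce simp: pre_sol_def powr_numeral)
  next
    case False
    then have \<alpha>': "\<alpha> < 4" "0 < 4 - \<alpha>" using \<alpha> by auto
    define c where "c = Gamma (4 - \<alpha>)"
    have c: "c > 0" using \<alpha>' by (simp add: c_def)
    have G: "Gamma (\<alpha> - 1) > 0" "Gamma \<alpha> > 0" using \<alpha> by auto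
    have wv: "weakly_singular \<sigma> v" by (rule weakly_singular_continuous[OF v h(2)])
    define J where "J = (\<lambda>x. integral {0..x} (\<lambda>s. (x - s) powr (3 - \<alpha>) * v s))"
    have J: "J x = c * RL (4 - \<alpha>) v x" if "x < 1" for x
      using weakly_singular_integrable_on(2)[OF wv h(3) \<alpha>'(2), of x] that by (simp add: J_def c_def)
    have D': "has_nth_deriv 4 J (c * h t) t" if "t \<in> {0<..<1}" for t
      using D[OF that] False c by (auto simp: has_RL_deriv_def J_def c_def)
    have "((\<lambda>t. c * (RL (4 - \<alpha>) v t / t)) \<longlongrightarrow> c * 0) (at_right 0)"
      by (intro tendsto_intros RL_tendsto_div_zero[OF wv h(2,3) \<alpha>'(2) vlim])
    moreover have "\<forall>\<^sub>F t in at_right 0. c * (RL (4 - \<alpha>) v t / t) = J t / t"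
      unfolding eventually_at_right_field by (intro exI[of _ 1]) (auto simp: J)
    ultimately have "((\<lambda>t. J t / t) \<longlongrightarrow> c * 0) (at_right 0)"
      by (rule Lim_transform_eventually)
    then obtain c2 c3 where c23: "\<And>t. t \<in> {0<..<1} \<Longrightarrow> J t = c * RL 4 h t + (c2 * t ^ 2 + c3 * t ^ 3)"
      using cubic[OF D'] by auto
    \<comment> \<open>\<open>A\<close> and \<open>B\<close> undo the factors
      \<open>Gamma (\<alpha> - 1) / 2\<close> and \<open>Gamma \<alpha> / 6\<close> from
      \<open>RL_pre_sol\<close>.\<close>
    define A where "A = c2 / c * 2 / Gamma (\<alpha> - 1)"
    define B where "B = c3 / c * 6 / Gamma \<alpha>"
    have "v t = pre_sol \<alpha> h A B t" if t: "t \<in> {0<..<1}" for t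
    proof (rule RL_inj[OF v pre_sol_continuous_on[OF h(1,3) \<alpha>(1)] \<alpha>'(2) _ _ t])
      fix t :: real assume t: "t \<in> {0<..<1}"
      have "c * RL (4 - \<alpha>) v t = c * RL 4 h t + (c2 * t ^ 2 + c3 * t ^ 3)"
        using c23[OF t] J[of t] t by simp
      then have "RL (4 - \<alpha>) v t = RL 4 h t + (c2 / c * t ^ 2 + c3 / c * t ^ 3)"
        using c by (simp add: field_simps)
      also have "\<dots> = RL (4 - \<alpha>) (pre_sol \<alpha> h A B) t"
        using RL_pre_sol[OF h(1-3) \<alpha>(1) \<alpha>'(1), of t A B] t G by (simp add: A_def B_def)
      finally show "RL (4 - \<alpha>) v t = RL (4 - \<alpha>) (pre_sol \<alpha> h A B) t" .
    qed (use \<alpha> in auto)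
    then show ?thesis by blast
  qed
  then obtain A B where AB: "\<And>t. t \<in> {0<..<1} \<Longrightarrow> v t - pre_sol \<alpha> h A B t = 0" by auto
  \<comment> \<open>Continuity extends the identity from the open interval to its endpoints.\<close>
  have "v t - pre_sol \<alpha> h A B t = 0" if "t \<in> {0..1}" for t
    by (rule continuous_constant_on_closure[of "{0<..<1::real}" "\<lambda>t. v t - pre_sol \<alpha> h A B t"])
       (use that AB in \<open>auto intro!: continuous_intros v pre_sol_continuous_on[OF h(1,3) \<alpha>(1)]\<close>)
  then show thesis using that by fastforce
qed

text \<open>The two conditions at \<open>1\<close> are linear equations for \<open>A\<close> and
  \<open>B\<close> with determinant \<open>(\<alpha> - 1) - (\<alpha> - 2) = 1\<close>, so they
  force the coefficients of \<open>bvp_sol\<close>.\<close>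

lemma bvp_sol_unique:
  assumes h: "weakly_singular \<sigma> h" "0 \<le> \<sigma>" "\<sigma> < 1" "continuous_on {0<..<1} h"
    and \<alpha>: "3 < \<alpha>" "\<alpha> \<le> 4" and v: "continuous_on {0..1} v"
    and D: "\<And>t. t \<in> {0<..<1} \<Longrightarrow> has_RL_deriv \<alpha> v (h t) t"
    and bc: "v 0 = 0" "(v has_real_derivative 0) (at 0 within {0..1})"
      "v 1 = 0" "(v has_real_derivative 0) (at 1 within {0..1})"
    and t: "t \<in> {0..1}"
  shows "v t = bvp_sol \<alpha> h t"
proof -
  obtain A B where AB: "\<And>t. t \<in> {0..1} \<Longrightarrow> v t = pre_sol \<alpha> h A B t"
    using pre_sol_of_RL_deriv[OF h \<alpha> v D bc(1,2)] by blast
  have 1: "RL \<alpha> h 1 + A + B = 0" using AB[of 1] bc(3) by (simp add: pre_sol_def)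
  have "(pre_sol \<alpha> h A B has_real_derivative 0) (at 1 within {0..1})"
    by (rule has_field_derivative_transform_within[OF bc(4) zero_less_one]) (auto simp: AB)
  moreover have "(pre_sol \<alpha> h A B has_real_derivative RL (\<alpha> - 1) h 1 + A * (\<alpha> - 2) + B * (\<alpha> - 1)) (at 1 within {0..1})"
    using pre_sol_has_derivative[OF h(1,3) \<alpha>(1), of 1] by simp
  moreover have "at (1::real) within {0..1} \<noteq> bot" by (simp add: at_within_Icc_at_left)
  ultimately have 2: "RL (\<alpha> - 1) h 1 + A * (\<alpha> - 2) + B * (\<alpha> - 1) = 0"
    using vector_derivative_unique_within
    unfolding has_real_derivative_iff_has_vector_derivative by metis
  have "A = RL (\<alpha> - 1) h 1 - (\<alpha> - 1) * RL \<alpha> h 1 \<and> B = (\<alpha> - 2) * RL \<alpha> h 1 - RL (\<alpha> - 1) h 1"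
  proof -
    have A: "A = - RL \<alpha> h 1 - B" using 1 by simp
    from 2 have B: "B = (\<alpha> - 2) * RL \<alpha> h 1 - RL (\<alpha> - 1) h 1"
      unfolding A by (simp add: algebra_simps)
    show ?thesis using A B by (simp add: algebra_simps)
  qed
  then show ?thesis using AB[OF t] by (simp add: bvp_sol_def)
qed

section \<open>The Green function\<close>

text \<open>The function \<open>(1 - x) powr q + q * x\<close> has derivative
  \<open>q * (1 - (1 - x) powr (q - 1))\<close>, which is positive on \<open>(0,r)\<close>.\<close>

lemma bernoulli_strict:
  fixes q r :: real
  assumes "1 < q" "0 < r" "r \<le> 1"
  shows "1 - q * r < (1 - r) powr q"
proof -
  let ?f = "\<lambda>x. (1 - x) powr q + q * x"
  have "?f 0 < ?f r"
  proof (rule DERIV_pos_imp_increasing_open[OF assms(2)])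
    fix x assume x: "0 < x" "x < r"
    have "(1 - x) powr (q - 1) < 1 powr (q - 1)"
      using x assms by (intro powr_less_mono2) auto
    then have "0 < q * (1 - (1 - x) powr (q - 1))" using assms by simp
    moreover have "(?f has_real_derivative q * (1 - (1 - x) powr (q - 1))) (at x)"
      using x assms by (auto intro!: derivative_eq_intros simp: algebra_simps powr_diff)
    ultimately show "\<exists>y. (?f has_real_derivative y) (at x) \<and> 0 < y" by blast
  next
    show "continuous_on {0..r} ?f"
      using assms by (intro continuous_on_add continuous_on_powr' continuous_intros) auto
  qed
  then show ?thesis by simp
qed

text \<open>Above the diagonal the bracket is visibly positive. Below it, put
  \<open>A = t * (1 - s)\<close> and \<open>r = s * (1 - t) / A\<close>; then
  \<open>t - s = A * (1 - r)\<close>, and up to a positive factor the kernel is the defect in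
  Bernoulli's inequality with exponent \<open>\<alpha> - 1\<close>.\<close>

lemma green_pos:
  assumes "3 < \<alpha>" "t \<in> {0<..<1}" "s \<in> {0<..<1}"
  shows "0 < green \<alpha> t s"
proof -
  have G: "Gamma \<alpha> > 0" using assms by simp
  show ?thesis
  proof (cases "t \<le> s")
    \<comment> \<open>The diagonal belongs here too: \<open>(t - s) powr (\<alpha> - 1)\<close> is
      \<open>0\<close> for \<open>s = t\<close>, so both branches of \<open>green\<close>
      agree.\<close>
    case True
    have "0 < (1 - s) powr (\<alpha> - 2) * t powr (\<alpha> - 2) * ((s - t) + (\<alpha> - 2) * (1 - t) * s)"
      using assms True by (intro mult_pos_pos add_nonneg_pos) auto
    then show ?thesis using G True by (auto simp: green_def intro!: divide_pos_pos)
  next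
    case False
    define A where "A = t * (1 - s)"
    define r where "r = s * (1 - t) / A"
    have A: "0 < A" using assms by (auto simp: A_def)
    have rA: "A * r = s * (1 - t)" using A by (simp add: r_def)
    have ts: "t - s = A * (1 - r)" using rA by (simp add: A_def algebra_simps)
    have r: "0 < r" using A assms by (auto simp: r_def)
    have r1: "r < 1" using ts False A by (metis diff_gt_0_iff_gt not_le zero_less_mult_pos)
    have "(t - s) powr (\<alpha> - 1) = A powr (\<alpha> - 1) * (1 - r) powr (\<alpha> - 1)"
      unfolding ts by (rule powr_mult)
    moreover have "(1 - s) powr (\<alpha> - 2) * t powr (\<alpha> - 2) * ((s - t) + (\<alpha> - 2) * (1 - t) * s)
       = A powr (\<alpha> - 1) * ((\<alpha> - 1) * r - 1)"
    proof -
      have "(s - t) + (\<alpha> - 2) * (1 - t) * s = - (t - s) + (\<alpha> - 2) * (A * r)"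
        unfolding rA by (simp add: algebra_simps)
      also have "\<dots> = A * ((\<alpha> - 1) * r - 1)" unfolding ts by (simp add: algebra_simps)
      finally have 1: "(s - t) + (\<alpha> - 2) * (1 - t) * s = A * ((\<alpha> - 1) * r - 1)" .
      have 2: "(1 - s) powr (\<alpha> - 2) * t powr (\<alpha> - 2) = A powr (\<alpha> - 2)"
        using assms by (simp add: A_def powr_mult)
      have 3: "A powr (\<alpha> - 2) * A = A powr (\<alpha> - 1)"
        using powr_add[of A "\<alpha> - 2" 1] A by simp
      show ?thesis unfolding 1 2 3[symmetric] by simp
    qed
    ultimately have "green \<alpha> t s = A powr (\<alpha> - 1) * ((1 - r) powr (\<alpha> - 1) - (1 - (\<alpha> - 1) * r)) / Gamma \<alpha>"
      using False by (simp add: green_def algebra_simps)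
    then show ?thesis
      using bernoulli_strict[of "\<alpha> - 1" r] r r1 A G assms(1) by simp
  qed
qed

text \<open>For \<open>t = 0\<close> and \<open>t = 1\<close> the kernel vanishes: in the first case
  through the factor \<open>0 powr (\<alpha> - 2)\<close>, in the second because its two summands
  cancel.\<close>

lemma green_nonneg:
  assumes "3 < \<alpha>" "t \<in> {0..1}" "s \<in> {0<..<1}"
  shows "0 \<le> green \<alpha> t s"
proof -
  consider "t = 0" | "t = 1" | "t \<in> {0<..<1}" using assms(2) by fastforce
  then show ?thesis
  proof cases
    case 1
    then show ?thesis using assms by (simp add: green_def)
  next
    case 2
    have "(1 - s) powr (\<alpha> - 1) = (1 - s) powr (\<alpha> - 2) * (1 - s)"
      using powr_add[of "1 - s" "\<alpha> - 2" 1] assms by simp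
    then show ?thesis using 2 assms by (simp add: green_def algebra_simps)
  next
    case 3
    then show ?thesis using green_pos[OF assms(1) _ assms(3)] by (simp add: less_imp_le)
  qed
qed

lemma has_bochner_integral_RL:
  assumes "weakly_singular \<sigma> h" "\<sigma> < 1" "0 < a" "x \<le> 1"
  shows "has_bochner_integral lborel (\<lambda>s. indicator {0<..<x} s * ((x - s) powr (a - 1) * h s))
           (Gamma a * RL a h x)"
  using RL_kernel_integrable[OF assms] Gamma_real_pos[OF assms(3)]
  by (simp add: has_bochner_integral_iff RL_def set_lebesgue_integral_def set_integrable_def)

text \<open>The bracket in \<open>green\<close> equals \<open>(t * (\<alpha> - 2) - (\<alpha> - 1))
  * (1 - s) + (\<alpha> - 1) * (1 - t)\<close>. So the kernel is a combination of those of
  \<open>RL \<alpha>\<close> at \<open>t\<close>, \<open>RL \<alpha>\<close> at \<open>1\<close> and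
  \<open>RL (\<alpha> - 1)\<close> at \<open>1\<close>, with the coefficients found in
  \<open>bvp_sol\<close>.\<close>

lemma has_bochner_integral_green:
  assumes h: "weakly_singular \<sigma> h" "\<sigma> < 1" and \<alpha>: "3 < \<alpha>" and t: "t \<in> {0..1}"
  shows "has_bochner_integral lborel (\<lambda>s. indicator {0<..<1} s * (green \<alpha> t s * h s)) (bvp_sol \<alpha> h t)"
proof -
  define c where "c = t powr (\<alpha> - 2) / Gamma \<alpha>"
  have G: "Gamma \<alpha> > 0" "Gamma (\<alpha> - 1) > 0" using \<alpha> by auto
  have G1: "Gamma \<alpha> = (\<alpha> - 1) * Gamma (\<alpha> - 1)"
    using Gamma_plus1[of "\<alpha> - 1"] \<alpha>
    by (cases "\<alpha> - 1 \<in> \<int>\<^sub>\<le>\<^sub>0") (auto dest: nonpos_Ints_nonpos)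
  have t1: "t powr (\<alpha> - 1) = t powr (\<alpha> - 2) * t"
    using powr_add[of t "\<alpha> - 2" 1] t \<alpha> by (cases "t = 0") auto
  note H = has_bochner_integral_mult_right[OF has_bochner_integral_RL[OF h]]
  have "has_bochner_integral lborel
     (\<lambda>s. 1 / Gamma \<alpha> * (indicator {0<..<t} s * ((t - s) powr (\<alpha> - 1) * h s)) +
        c * (t * (\<alpha> - 2) - (\<alpha> - 1)) * (indicator {0<..<1} s * ((1 - s) powr (\<alpha> - 1) * h s)) +
        c * ((\<alpha> - 1) * (1 - t)) * (indicator {0<..<1} s * ((1 - s) powr (\<alpha> - 1 - 1) * h s)))
     (1 / Gamma \<alpha> * (Gamma \<alpha> * RL \<alpha> h t) +
        c * (t * (\<alpha> - 2) - (\<alpha> - 1)) * (Gamma \<alpha> * RL \<alpha> h 1) +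
        c * ((\<alpha> - 1) * (1 - t)) * (Gamma (\<alpha> - 1) * RL (\<alpha> - 1) h 1))"
    using \<alpha> t by (intro has_bochner_integral_add H) auto
  moreover have "1 / Gamma \<alpha> * (Gamma \<alpha> * RL \<alpha> h t) +
        c * (t * (\<alpha> - 2) - (\<alpha> - 1)) * (Gamma \<alpha> * RL \<alpha> h 1) +
        c * ((\<alpha> - 1) * (1 - t)) * (Gamma (\<alpha> - 1) * RL (\<alpha> - 1) h 1) = bvp_sol \<alpha> h t"
  proof -
    have "c * ((\<alpha> - 1) * (1 - t)) * (Gamma (\<alpha> - 1) * RL (\<alpha> - 1) h 1)
        = c * Gamma \<alpha> * (1 - t) * RL (\<alpha> - 1) h 1" unfolding G1 by simp
    moreover have "c * Gamma \<alpha> = t powr (\<alpha> - 2)" using G by (simp add: c_def)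
    moreover have "c * (t * (\<alpha> - 2) - (\<alpha> - 1)) * (Gamma \<alpha> * RL \<alpha> h 1) =
        c * Gamma \<alpha> * (t * (\<alpha> - 2) - (\<alpha> - 1)) * RL \<alpha> h 1" by simp
    ultimately show ?thesis
      using G(1) by (simp add: bvp_sol_def pre_sol_def t1 algebra_simps)
  qed
  moreover have "1 / Gamma \<alpha> * (indicator {0<..<t} s * ((t - s) powr (\<alpha> - 1) * h s)) +
        c * (t * (\<alpha> - 2) - (\<alpha> - 1)) * (indicator {0<..<1} s * ((1 - s) powr (\<alpha> - 1) * h s)) +
        c * ((\<alpha> - 1) * (1 - t)) * (indicator {0<..<1} s * ((1 - s) powr (\<alpha> - 1 - 1) * h s))
      = indicator {0<..<1} s * (green \<alpha> t s * h s)" for s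
  proof (cases "s \<in> {0<..<1}")
    case True
    have p: "(1 - s) powr (\<alpha> - 1) = (1 - s) powr (\<alpha> - 2) * (1 - s)"
      using powr_add[of "1 - s" "\<alpha> - 2" 1] True by simp
    have "green \<alpha> t s = 1 / Gamma \<alpha> * (indicator {0<..<t} s * (t - s) powr (\<alpha> - 1)) +
        c * (1 - s) powr (\<alpha> - 2) * ((s - t) + (\<alpha> - 2) * (1 - t) * s)"
      using True by (cases "s = t") (auto simp: green_def c_def indicator_def add_divide_distrib mult_ac)
    moreover have "(s - t) + (\<alpha> - 2) * (1 - t) * s
        = (t * (\<alpha> - 2) - (\<alpha> - 1)) * (1 - s) + (\<alpha> - 1) * (1 - t)"
      by (simp add: algebra_simps)
    ultimately have "green \<alpha> t s = 1 / Gamma \<alpha> * (indicator {0<..<t} s * (t - s) powr (\<alpha> - 1)) +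
        c * (t * (\<alpha> - 2) - (\<alpha> - 1)) * (1 - s) powr (\<alpha> - 1) +
        c * ((\<alpha> - 1) * (1 - t)) * (1 - s) powr (\<alpha> - 2)"
      by (simp only: p) (simp add: distrib_left mult_ac)
    then show ?thesis using True by (simp add: distrib_left distrib_right mult_ac)
  next
    case False
    then have "s \<notin> {0<..<t}" using t by auto
    then show ?thesis using False by simp
  qed
  ultimately show ?thesis by simp
qed

lemma integral_green:
  assumes "weakly_singular \<sigma> h" "\<sigma> < 1" "3 < \<alpha>" "t \<in> {0..1}"
  shows "integral {0..1} (\<lambda>s. green \<alpha> t s * h s) = bvp_sol \<alpha> h t"
proof -
  have "set_integrable lborel {0<..<1} (\<lambda>s. green \<alpha> t s * h s)"
    "(LINT s:{0<..<1}|lborel. green \<alpha> t s * h s) = bvp_sol \<alpha> h t"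
    using has_bochner_integral_green[OF assms]
    by (auto simp: set_integrable_def set_lebesgue_integral_def has_bochner_integral_iff)
  then show ?thesis
    using set_borel_integral_eq_integral(2) by (metis integral_open_interval_real)
qed

section \<open>Linearity, monotonicity and positivity of the solution operator\<close>

lemma bvp_sol_lincomb:
  assumes "weakly_singular \<sigma> \<phi>" "weakly_singular \<sigma> \<psi>" "\<sigma> < 1" "3 < \<alpha>" "t \<le> 1"
  shows "bvp_sol \<alpha> (\<lambda>s. c * \<phi> s + d * \<psi> s) t = c * bvp_sol \<alpha> \<phi> t + d * bvp_sol \<alpha> \<psi> t"
  using RL_lincomb[OF assms(1-3)] assms(4,5)
  by (simp add: bvp_sol_def pre_sol_def algebra_simps)

lemma bvp_sol_mono:
  assumes "weakly_singular \<sigma> \<phi>" "weakly_singular \<sigma> \<psi>" "\<sigma> < 1" "3 < \<alpha>" "t \<in> {0..1}"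
    and "\<And>s. s \<in> {0<..<1} \<Longrightarrow> \<phi> s \<le> \<psi> s"
  shows "bvp_sol \<alpha> \<phi> t \<le> bvp_sol \<alpha> \<psi> t"
proof -
  note B = has_bochner_integral_green[OF assms(1,3,4,5)] has_bochner_integral_green[OF assms(2,3,4,5)]
  have "indicator {0<..<1} s * (green \<alpha> t s * \<phi> s) \<le> indicator {0<..<1} s * (green \<alpha> t s * \<psi> s)" for s
    using green_nonneg[OF assms(4,5)] assms(6)
    by (cases "s \<in> {0<..<1}") (auto intro!: mult_left_mono)
  from integral_mono[OF integrable.intros[OF B(1)] integrable.intros[OF B(2)] this]
  show ?thesis by (simp only: has_bochner_integral_integral_eq[OF B(1)] has_bochner_integral_integral_eq[OF B(2)])
qed

lemma bvp_sol_nonneg: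
  assumes "weakly_singular \<sigma> h" "\<sigma> < 1" "3 < \<alpha>" "t \<in> {0..1}"
    and "\<And>s. s \<in> {0<..<1} \<Longrightarrow> 0 \<le> h s"
  shows "0 \<le> bvp_sol \<alpha> h t"
  \<comment> \<open>The comparison function is zero, written as \<open>0 * h s\<close>; linearity
    with both coefficients \<open>0\<close> shows that its solution vanishes.\<close>
  using bvp_sol_mono[OF weakly_singular_cmult[OF assms(1), of 0] assms(1-4)] assms(5)
    bvp_sol_lincomb[OF assms(1,1-3), of t 0 0] assms(4) by simp

text \<open>If the value were \<open>0\<close>, the nonnegative integrand
  \<open>green \<alpha> t s * h s\<close> would vanish almost everywhere, yet it is positive on an
  interval to the right of \<open>0\<close>.\<close>

lemma bvp_sol_pos:
  assumes h: "weakly_singular \<sigma> h" "\<sigma> < 1" and \<alpha>: "3 < \<alpha>" and t: "t \<in> {0<..<1}"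
    and nonneg: "\<And>s. s \<in> {0<..<1} \<Longrightarrow> 0 \<le> h s"
    and pos: "\<forall>\<^sub>F s in at_right 0. 0 < h s"
  shows "0 < bvp_sol \<alpha> h t"
proof (rule ccontr)
  assume "\<not> 0 < bvp_sol \<alpha> h t"
  have t': "t \<in> {0..1}" using t by auto
  have 0: "bvp_sol \<alpha> h t = 0"
    using bvp_sol_nonneg[OF h \<alpha> t' nonneg] \<open>\<not> 0 < bvp_sol \<alpha> h t\<close> by simp
  let ?F = "\<lambda>s. indicator {0<..<1} s * (green \<alpha> t s * h s)"
  have F: "integrable lborel ?F" "integral\<^sup>L lborel ?F = 0"
    using has_bochner_integral_green[OF h \<alpha> t'] 0 by (auto simp: has_bochner_integral_iff)
  have "AE s in lborel. 0 \<le> ?F s"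
    using green_nonneg[OF \<alpha> t'] nonneg by (auto simp: indicator_def)
  then have AE0: "AE s in lborel. ?F s = 0"
    using integral_nonneg_eq_0_iff_AE[OF F(1)] F(2) by simp
  obtain d where d: "0 < d" "\<And>s. 0 < s \<Longrightarrow> s < d \<Longrightarrow> 0 < h s"
    using pos unfolding eventually_at_right_field by auto
  define e where "e = min d 1"
  have e: "0 < e" using d by (simp add: e_def)
  have "?F s \<noteq> 0" if "s \<in> {0<..<e}" for s
    using that d(2)[of s] green_pos[OF \<alpha> t, of s] by (auto simp: e_def)
  then have "AE s in lborel. s \<notin> {0<..<e}"
    using AE0 by (auto elim!: eventually_mono)
  then have "emeasure lborel {0<..<e} = 0"
    by (subst (asm) AE_iff_measurable[of "{0<..<e}"]) auto
  then show False using e by simp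
qed

section \<open>The fixed point\<close>

text \<open>The ratio of \<open>d / (1 + \<tau> * sqrt d)\<^sup>2\<close> to \<open>d\<close> tends
  to \<open>1\<close> as \<open>d\<close> tends to \<open>0\<close>, so there is no uniform
  contraction factor and summability of the iterates replaces the geometric series. Any uniform
  bound \<open>d\<close> stands in for the supremum norm.\<close>

lemma sublinear_contraction_fixpoint:
  fixes \<Phi> :: "(real \<Rightarrow> real) \<Rightarrow> real \<Rightarrow> real"
  defines "X \<equiv> {u. continuous_on {0..1} u \<and> (\<forall>t\<in>{0..1}. 0 \<le> u t)}"
  assumes \<tau>: "0 < \<tau>"
    and \<Phi>: "\<And>u. u \<in> X \<Longrightarrow> \<Phi> u \<in> X"
    and contr: "\<And>u v d t. u \<in> X \<Longrightarrow> v \<in> X \<Longrightarrow> 0 \<le> d \<Longrightarrow> (\<And>s. s \<in> {0..1} \<Longrightarrow> \<bar>u s - v s\<bar> \<le> d)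
       \<Longrightarrow> t \<in> {0..1} \<Longrightarrow> \<bar>\<Phi> u t - \<Phi> v t\<bar> \<le> d / (1 + \<tau> * sqrt d)\<^sup>2"
  obtains u where "u \<in> X" "\<And>t. t \<in> {0..1} \<Longrightarrow> \<Phi> u t = u t"
    "\<And>v t. v \<in> X \<Longrightarrow> (\<And>s. s \<in> {0..1} \<Longrightarrow> \<Phi> v s = v s) \<Longrightarrow> t \<in> {0..1} \<Longrightarrow> v t = u t"
proof -
  \<comment> \<open>the \<open>n\<close>-th iterate at \<open>q\<^sup>2\<close> of \<open>d \<mapsto> d / (1 + \<tau> \<surd>d)\<^sup>2\<close>\<close>
  define a where "a q n = (q / (1 + real n * (\<tau> * q)))\<^sup>2" for q n
  have a_nonneg: "0 \<le> a q n" for q n by (simp add: a_def)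
  have a_Suc: "a q n / (1 + \<tau> * sqrt (a q n))\<^sup>2 = a q (Suc n)" if q: "0 < q" for q n
  proof -
    have p: "0 < 1 + real n * (\<tau> * q)" "0 < 1 + real n * (\<tau> * q) + \<tau> * q"
      using mult_nonneg_nonneg[of "real n" "\<tau> * q"] mult_pos_pos[OF \<tau> q] by linarith+
    have s: "sqrt (a q n) = q / (1 + real n * (\<tau> * q))"
      unfolding a_def using p q by (simp add: less_imp_le)
    have "q / (1 + real n * (\<tau> * q)) / (1 + \<tau> * (q / (1 + real n * (\<tau> * q))))
        = q / (1 + real (Suc n) * (\<tau> * q))"
    proof -
      define P where "P = 1 + real n * (\<tau> * q)"
      have P: "P > 0" using p by (simp add: P_def)
      have "1 + \<tau> * (q / P) = (P + \<tau> * q) / P" using P by (simp add: add_divide_distrib)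
      moreover have "1 + real (Suc n) * (\<tau> * q) = P + \<tau> * q" by (simp add: P_def algebra_simps)
      ultimately show ?thesis using P by (simp flip: P_def)
    qed
    then show ?thesis unfolding s unfolding a_def by (simp only: power_divide[symmetric])
  qed
  have a_summable: "summable (a q)" if q: "0 < q" for q
  proof (rule summable_comparison_test')
    show "summable (\<lambda>n. 1 / \<tau>\<^sup>2 * inverse (real n ^ 2))"
      by (intro summable_mult inverse_power_summable) auto
    fix n :: nat assume n: "1 \<le> n"
    have "q / (1 + real n * (\<tau> * q)) \<le> q / (real n * (\<tau> * q))"
      using q n \<tau> by (intro divide_left_mono mult_pos_pos add_pos_pos) auto
    also have "\<dots> = 1 / (real n * \<tau>)" using q by simp
    finally have "a q n \<le> (1 / (real n * \<tau>))\<^sup>2"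
      unfolding a_def using q \<tau> by (intro power_mono) auto
    also have "\<dots> = 1 / \<tau>\<^sup>2 * inverse (real n ^ 2)"
      by (simp add: power_divide power_mult_distrib field_simps)
    finally show "norm (a q n) \<le> 1 / \<tau>\<^sup>2 * inverse (real n ^ 2)" using a_nonneg[of q n] by simp
  qed
  have bound: "\<exists>q>0. \<forall>t\<in>{0..1}. \<bar>u t - v t\<bar> \<le> a q 0" if "u \<in> X" "v \<in> X" for u v
  proof -
    have "bounded ((\<lambda>t. u t - v t) ` {0..1})"
      using that by (intro compact_imp_bounded compact_continuous_image continuous_intros) (auto simp: X_def)
    then obtain C where C: "\<forall>y\<in>(\<lambda>t. u t - v t) ` {0..1}. norm y \<le> C"
      unfolding bounded_iff by blast
    \<comment> \<open>\<open>q = max 1 C\<close> is positive, and \<open>a q 0\<close> is its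
      square, which dominates \<open>C\<close>.\<close>
    have "C \<le> (max 1 C)\<^sup>2"
      by (smt (verit) power2_eq_square mult_le_cancel_left1)
    then have "\<forall>t\<in>{0..1}. \<bar>u t - v t\<bar> \<le> a (max 1 C) 0" using C by (force simp: a_def)
    then show ?thesis by (intro exI[of _ "max 1 C"]) auto
  qed
  define U where "U n = (\<Phi> ^^ n) (\<lambda>_. 0)" for n
  have UX: "U n \<in> X" for n
    by (induction n) (auto simp: U_def \<Phi>, simp add: X_def)
  have U0: "U 0 = (\<lambda>_. 0)" by (simp add: U_def)
  obtain q where q: "0 < q" "\<And>t. t \<in> {0..1} \<Longrightarrow> \<bar>U 1 t - U 0 t\<bar> \<le> a q 0"
    using bound[OF UX UX, of 1 0] by blast
  have step: "\<bar>U (Suc n) t - U n t\<bar> \<le> a q n" if "t \<in> {0..1}" for n t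
    using that
  proof (induction n arbitrary: t)
    case (Suc n)
    have "\<bar>\<Phi> (U (Suc n)) t - \<Phi> (U n) t\<bar> \<le> a q n / (1 + \<tau> * sqrt (a q n))\<^sup>2"
      by (rule contr[OF UX UX a_nonneg Suc.IH Suc.prems])
    then show ?case unfolding a_Suc[OF q(1)] by (simp add: U_def)
  qed (use q in simp)
  define u where "u x = (\<Sum>n. U (Suc n) x - U n x)" for x
  \<comment> \<open>The M-test for the telescoping series of increments, majorised by
    \<open>a q\<close>.\<close>
  have "uniform_limit {0..1} (\<lambda>n x. \<Sum>i<n. U (Suc i) x - U i x) u sequentially"
    unfolding u_def[abs_def] using step a_summable[OF q(1)] by (intro Weierstrass_m_test) auto
  moreover have "(\<lambda>n x. \<Sum>i<n. U (Suc i) x - U i x) = U"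
    using sum_lessThan_telescope[of "\<lambda>i. U i _"] by (auto simp: U0 fun_eq_iff)
  ultimately have ul: "uniform_limit {0..1} U u sequentially" by simp
  have uX: "u \<in> X"
  proof -
    have "continuous_on {0..1} u"
      by (rule uniform_limit_theorem[OF _ ul]) (use UX in \<open>auto simp: X_def\<close>)
    moreover have "0 \<le> u t" if "t \<in> {0..1}" for t
      using tendsto_uniform_limitI[OF ul that] UX that
      by (intro tendsto_lowerbound[where F=sequentially]) (auto simp: X_def)
    ultimately show ?thesis by (simp add: X_def)
  qed
  have fixed: "\<Phi> u t = u t" if t: "t \<in> {0..1}" for t
  proof -
    have "\<bar>\<Phi> u t - u t\<bar> \<le> 0 + e" if e: "0 < e" for e
    proof -
      have ev: "\<forall>\<^sub>F n in sequentially. \<forall>x\<in>{0..1}. dist (U n x) (u x) < e / 2"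
        using uniform_limitD[OF ul, of "e/2"] e by simp
      then obtain n where n: "\<And>m x. m \<ge> n \<Longrightarrow> x \<in> {0..1} \<Longrightarrow> \<bar>U m x - u x\<bar> < e / 2"
        unfolding eventually_sequentially dist_real_def by blast
      \<comment> \<open>The map does not increase distances, as the denominator is at least
        \<open>1\<close>; so the limit \<open>u\<close> is moved by at most
        \<open>e / 2 + e / 2\<close>.\<close>
      have "\<bar>\<Phi> u t - \<Phi> (U n) t\<bar> \<le> (e / 2) / (1 + \<tau> * sqrt (e / 2))\<^sup>2"
        using n[of n] e by (intro contr[OF uX UX _ _ t]) (auto simp: abs_minus_commute less_imp_le)
      also have "\<dots> \<le> (e / 2) / 1"
      proof -
        have "1 \<le> 1 + \<tau> * sqrt (e / 2)" using \<tau> e by simp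
        then have "1 \<le> (1 + \<tau> * sqrt (e / 2))\<^sup>2" by (rule one_le_power)
        then show ?thesis using e by (intro divide_left_mono) auto
      qed
      finally have "\<bar>\<Phi> u t - U (Suc n) t\<bar> \<le> e / 2" by (simp add: U_def)
      moreover have "\<bar>U (Suc n) t - u t\<bar> < e / 2" using n t by simp
      ultimately show ?thesis by arith
    qed
    then have "\<bar>\<Phi> u t - u t\<bar> \<le> 0" by (rule field_le_epsilon)
    then show ?thesis by simp
  qed
  have "v t = u t" if v: "v \<in> X" "\<And>s. s \<in> {0..1} \<Longrightarrow> \<Phi> v s = v s" and t: "t \<in> {0..1}" for v t
  proof -
    obtain q where q: "0 < q" "\<And>t. t \<in> {0..1} \<Longrightarrow> \<bar>v t - u t\<bar> \<le> a q 0"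
      using bound[OF v(1) uX] by blast
    \<comment> \<open>Applying the map to two fixed points leaves them in place but improves the
      bound from \<open>a q n\<close> to \<open>a q (Suc n)\<close>; these bounds tend to
      \<open>0\<close>.\<close>
    have le: "\<bar>v t - u t\<bar> \<le> a q n" if "t \<in> {0..1}" for n t
      using that
    proof (induction n arbitrary: t)
      case (Suc n)
      have "\<bar>\<Phi> v t - \<Phi> u t\<bar> \<le> a q n / (1 + \<tau> * sqrt (a q n))\<^sup>2"
        by (rule contr[OF v(1) uX a_nonneg Suc.IH Suc.prems])
      then show ?case unfolding a_Suc[OF q(1)] using v(2) fixed Suc.prems by simp
    qed (use q in simp)
    have "\<bar>v t - u t\<bar> \<le> 0"
      using summable_LIMSEQ_zero[OF a_summable[OF q(1)]] le[OF t] by (intro LIMSEQ_le_const) auto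
    then show ?thesis by simp
  qed
  then show thesis using that uX fixed by blast
qed

text \<open>The expression is the square of \<open>x / (1 + \<tau> * x)\<close> at
  \<open>x = sqrt d\<close>, and this quotient increases in \<open>x \<ge> 0\<close>.\<close>

lemma sublinear_mono:
  fixes \<tau> d e :: real
  assumes "0 < \<tau>" "0 \<le> e" "e \<le> d"
  shows "e / (1 + \<tau> * sqrt e)\<^sup>2 \<le> d / (1 + \<tau> * sqrt d)\<^sup>2"
proof -
  have p: "0 < 1 + \<tau> * sqrt e" "0 < 1 + \<tau> * sqrt d"
    using assms by (auto intro!: add_pos_nonneg)
  have "sqrt e \<le> sqrt d" using assms by simp
  then have "sqrt e / (1 + \<tau> * sqrt e) \<le> sqrt d / (1 + \<tau> * sqrt d)"
    using p by (simp add: field_simps)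
  then have "(sqrt e / (1 + \<tau> * sqrt e))\<^sup>2 \<le> (sqrt d / (1 + \<tau> * sqrt d))\<^sup>2"
    using assms p by (intro power_mono) (auto intro!: divide_nonneg_pos)
  then show ?thesis using assms by (simp add: power_divide)
qed

text \<open>A continuous function on a compact interval attains its supremum, so
  \<open>GREATEST\<close> denotes a true maximum.\<close>

lemma Greatest_image_ge:
  fixes F :: "real \<Rightarrow> real"
  assumes "continuous_on {0..1} F" "t \<in> {0..1}"
  shows "F t \<le> (GREATEST m. m \<in> F ` {0..1})"
proof -
  obtain x where x: "x \<in> {0..1}" "\<And>y. y \<in> {0..1} \<Longrightarrow> F y \<le> F x"
    using continuous_attains_sup[of "{0..1::real}" F] assms(1) by auto
  then have "(GREATEST m. m \<in> F ` {0..1}) = F x"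
    by (intro Greatest_equality) auto
  then show ?thesis using x(2) assms(2) by simp
qed

theorem theorem7:
  fixes \<sigma> \<alpha> N \<Lambda> \<tau> :: real
    and f :: "real \<Rightarrow> real \<Rightarrow> real"
    and g :: "real \<Rightarrow> real \<Rightarrow> real" \<comment> \<open>the continuous extension of \<open>t powr \<sigma> * f t y\<close> to \<open>t = 0\<close>\<close>
  assumes "0 < \<sigma>" "\<sigma> < 1"
    and "3 < \<alpha>" "\<alpha> \<le> 4"
    and "\<And>t y. t \<in> {0<..1} \<Longrightarrow> 0 \<le> y \<Longrightarrow> 0 \<le> f t y"
    and "continuous_on ({0<..1} \<times> {0..}) (\<lambda>(t, y). f t y)"
    and "\<And>y. 0 \<le> y \<Longrightarrow> filterlim (\<lambda>t. f t y) at_top (at_right 0)"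
    and "continuous_on ({0..1} \<times> {0..}) (\<lambda>(t, y). g t y)"
    and "\<And>t y. t \<in> {0<..1} \<Longrightarrow> 0 \<le> y \<Longrightarrow> g t y = t powr \<sigma> * f t y"
    and "N = (GREATEST m. m \<in> (\<lambda>t. integral {0..1} (\<lambda>s. green \<alpha> t s * s powr (- \<sigma>))) ` {0..1})"
    and "0 < \<Lambda>" "\<Lambda> \<le> 1 / N" "0 < \<tau>"
    and "\<And>t x y. t \<in> {0..1} \<Longrightarrow> 0 \<le> x \<Longrightarrow> 0 \<le> y \<Longrightarrow>
           \<bar>g t x - g t y\<bar> \<le> \<Lambda> * \<bar>x - y\<bar> / (1 + \<tau> * sqrt \<bar>x - y\<bar>)\<^sup>2"
    and "\<And>t. t \<in> {0..1} \<Longrightarrow> mono_on {0..} (g t)"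
  shows "\<exists>u. nonneg_solution \<alpha> f u \<and>
             (\<forall>v. nonneg_solution \<alpha> f v \<longrightarrow> (\<forall>t\<in>{0..1}. v t = u t)) \<and>
             (\<forall>t\<in>{0<..<1}. 0 < u t)"
proof -
  note \<sigma> = assms(1,2) and \<alpha> = assms(3,4) and f_nonneg = assms(5) and f_cont = assms(6)
    and f_lim = assms(7) and g_cont = assms(8) and g_eq = assms(9) and N = assms(10)
    and \<Lambda> = assms(11,12) and \<tau> = assms(13) and g_contr = assms(14) and g_mono = assms(15)
  define X where "X = {u :: real \<Rightarrow> real. continuous_on {0..1} u \<and> (\<forall>t\<in>{0..1}. 0 \<le> u t)}"
  define \<Phi> where "\<Phi> u = bvp_sol \<alpha> (\<lambda>s. f s (u s))" for u
  have f_eq: "f t y = g t y * t powr (- \<sigma>)" if "t \<in> {0<..1}" "0 \<le> y" for t y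
    using g_eq[OF that] that by (simp add: powr_minus field_simps)
  have h_cont: "continuous_on {0<..1} (\<lambda>s. f s (u s))" if "u \<in> X" for u
    by (rule continuous_on_compose2[OF f_cont, of _ "\<lambda>s. (s, u s)", simplified])
       (use that in \<open>auto simp: X_def intro!: continuous_intros intro: continuous_on_subset\<close>)
  have h: "weakly_singular \<sigma> (\<lambda>s. f s (u s))" "continuous_on {0<..<1} (\<lambda>s. f s (u s))" if u: "u \<in> X" for u
  proof -
    have "continuous_on {0..1} (\<lambda>s. g s (u s))"
      by (rule continuous_on_compose2[OF g_cont, of _ "\<lambda>s. (s, u s)", simplified])
         (use u in \<open>auto simp: X_def intro!: continuous_intros\<close>)
    then have "bounded ((\<lambda>s. g s (u s)) ` {0..1})"
      by (intro compact_imp_bounded compact_continuous_image) auto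
    then obtain C where C: "\<forall>y\<in>(\<lambda>s. g s (u s)) ` {0..1}. norm y \<le> C"
      unfolding bounded_iff by blast
    show "weakly_singular \<sigma> (\<lambda>s. f s (u s))"
    proof (rule weakly_singularI)
      show "set_borel_measurable lborel {0<..1} (\<lambda>s. f s (u s))"
        using borel_measurable_continuous_on_indicator[OF _ h_cont[OF u]]
        by (simp add: set_borel_measurable_def)
      fix s :: real assume s: "s \<in> {0<..1}"
      then have us: "0 \<le> u s" using u by (auto simp: X_def)
      have "\<bar>f s (u s)\<bar> = \<bar>g s (u s)\<bar> * s powr (- \<sigma>)"
        unfolding f_eq[OF s us] by (simp add: abs_mult)
      also have "\<dots> \<le> C * s powr (- \<sigma>)"
        using C s by (intro mult_right_mono) auto
      finally show "\<bar>f s (u s)\<bar> \<le> C * s powr (- \<sigma>)" .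
    qed
    show "continuous_on {0<..<1} (\<lambda>s. f s (u s))"
      by (rule continuous_on_subset[OF h_cont[OF u]]) auto
  qed
  have h_nonneg: "0 \<le> f s (u s)" if "u \<in> X" "s \<in> {0<..<1}" for u s
    using that f_nonneg[of s "u s"] by (auto simp: X_def)
  have \<Phi>X: "\<Phi> u \<in> X" if u: "u \<in> X" for u
    using pre_sol_continuous_on[OF h(1)[OF u] \<sigma>(2) \<alpha>(1)]
      bvp_sol_nonneg[OF h(1)[OF u] \<sigma>(2) \<alpha>(1) _ h_nonneg[OF u]]
    by (auto simp: X_def \<Phi>_def bvp_sol_def)
  have ws: "weakly_singular \<sigma> (\<lambda>s. s powr (- \<sigma>))" by (rule weakly_singular_powr) simp
  have "bvp_sol \<alpha> (\<lambda>s. s powr (- \<sigma>)) t \<le> N" if "t \<in> {0..1}" for t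
  proof -
    \<comment> \<open>\<open>N\<close> is the maximum of the solution operator applied to the weight
      \<open>s powr (- \<sigma>)\<close>.\<close>
    have "N = (GREATEST m. m \<in> bvp_sol \<alpha> (\<lambda>s. s powr (- \<sigma>)) ` {0..1})"
      unfolding N by (simp only: integral_green[OF ws \<sigma>(2) \<alpha>(1)] cong: image_cong)
    then show ?thesis
      using Greatest_image_ge[OF _ that] pre_sol_continuous_on[OF ws \<sigma>(2) \<alpha>(1)]
      by (simp add: bvp_sol_def)
  qed
  \<comment> \<open>For \<open>N \<le> 0\<close> the quotient \<open>1 / N\<close> would not be
    positive, also for \<open>N = 0\<close> where it is \<open>0\<close>; this contradicts
    \<open>0 < \<Lambda> \<le> 1 / N\<close>.\<close>
  moreover have "0 < N" using \<Lambda> by (smt (verit) divide_nonpos_nonneg zero_less_divide_iff)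
  ultimately have N_le: "\<Lambda> * bvp_sol \<alpha> (\<lambda>s. s powr (- \<sigma>)) t \<le> 1" if "t \<in> {0..1}" for t
  proof -
    have "\<Lambda> * bvp_sol \<alpha> (\<lambda>s. s powr (- \<sigma>)) t \<le> \<Lambda> * N"
      using that \<Lambda> \<open>\<And>t. t \<in> {0..1} \<Longrightarrow> bvp_sol \<alpha> (\<lambda>s. s powr (- \<sigma>)) t \<le> N\<close>
      by (intro mult_left_mono) auto
    also have "\<dots> \<le> 1" using \<Lambda>(2) \<open>0 < N\<close> by (simp add: field_simps)
    finally show ?thesis .
  qed
  \<comment> \<open>Pointwise, \<open>f s (u s)\<close> exceeds \<open>f s (v s)\<close> by at most
    \<open>\<Lambda> * K * s powr (- \<sigma>)\<close>. The monotone linear solution operator turns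
    this excess into at most \<open>\<Lambda> * N * K\<close>, hence at most \<open>K\<close>.
    Exchanging \<open>u\<close> and \<open>v\<close> gives the absolute value.\<close>
  have one_sided: "\<Phi> u t \<le> \<Phi> v t + d / (1 + \<tau> * sqrt d)\<^sup>2"
    if u: "u \<in> X" and v: "v \<in> X" and d: "0 \<le> d" and uv: "\<And>s. s \<in> {0..1} \<Longrightarrow> \<bar>u s - v s\<bar> \<le> d"
      and t: "t \<in> {0..1}" for u v d t
  proof -
    define K where "K = d / (1 + \<tau> * sqrt d)\<^sup>2"
    have K: "0 \<le> K" using d by (simp add: K_def)
    have "\<Phi> u t \<le> bvp_sol \<alpha> (\<lambda>s. 1 * f s (v s) + (\<Lambda> * K) * s powr (- \<sigma>)) t"
      unfolding \<Phi>_def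
    proof (rule bvp_sol_mono[OF h(1)[OF u] weakly_singular_lincomb[OF h(1)[OF v] ws] \<sigma>(2) \<alpha>(1) t])
      fix s :: real assume s: "s \<in> {0<..<1}"
      have us: "0 \<le> u s" "0 \<le> v s" using u v s by (auto simp: X_def)
      have "g s (u s) - g s (v s) \<le> \<Lambda> * (\<bar>u s - v s\<bar> / (1 + \<tau> * sqrt \<bar>u s - v s\<bar>)\<^sup>2)"
        using g_contr[of s "u s" "v s"] s us by auto
      also have "\<dots> \<le> \<Lambda> * K"
        unfolding K_def using \<Lambda> \<tau> uv[of s] s by (intro mult_left_mono sublinear_mono) auto
      finally have "g s (u s) * s powr (- \<sigma>) \<le> (g s (v s) + \<Lambda> * K) * s powr (- \<sigma>)"
        by (intro mult_right_mono) auto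
      then show "f s (u s) \<le> 1 * f s (v s) + (\<Lambda> * K) * s powr (- \<sigma>)"
        using f_eq[of s "u s"] f_eq[of s "v s"] s us by (simp add: distrib_right)
    qed
    also have "\<dots> = \<Phi> v t + K * (\<Lambda> * bvp_sol \<alpha> (\<lambda>s. s powr (- \<sigma>)) t)"
      using bvp_sol_lincomb[OF h(1)[OF v] ws \<sigma>(2) \<alpha>(1), of t 1 "\<Lambda> * K"] t by (simp add: \<Phi>_def)
    also have "\<dots> \<le> \<Phi> v t + K"
      using mult_left_mono[OF N_le[OF t] K] by simp
    finally show ?thesis by (simp add: K_def)
  qed
  have contr: "\<bar>\<Phi> u t - \<Phi> v t\<bar> \<le> d / (1 + \<tau> * sqrt d)\<^sup>2"
    if "u \<in> X" "v \<in> X" "0 \<le> d" "\<And>s. s \<in> {0..1} \<Longrightarrow> \<bar>u s - v s\<bar> \<le> d" "t \<in> {0..1}" for u v d t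
    using one_sided[of u v d t] one_sided[of v u d t] that by (auto simp: abs_minus_commute)
  obtain u where u: "u \<in> X" "\<And>t. t \<in> {0..1} \<Longrightarrow> \<Phi> u t = u t"
    and u_unique: "\<And>v t. v \<in> X \<Longrightarrow> (\<And>s. s \<in> {0..1} \<Longrightarrow> \<Phi> v s = v s) \<Longrightarrow> t \<in> {0..1} \<Longrightarrow> v t = u t"
    using sublinear_contraction_fixpoint[OF \<tau>, of \<Phi>, folded X_def, OF \<Phi>X contr] by blast
  have u01: "u 0 = bvp_sol \<alpha> (\<lambda>s. f s (u s)) 0" "u 1 = bvp_sol \<alpha> (\<lambda>s. f s (u s)) 1"
    using u(2)[of 0] u(2)[of 1] by (simp_all add: \<Phi>_def)
  note bc = bvp_sol_boundary[OF h(1)[OF u(1)] \<sigma>(2) \<alpha>(1)]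
  have du: "(u has_real_derivative 0) (at x within {0..1})"
    if "(bvp_sol \<alpha> (\<lambda>s. f s (u s)) has_real_derivative 0) (at x within {0..1})" "x \<in> {0..1}" for x
    using u(2) by (intro has_field_derivative_transform_within[OF that(1) zero_less_one that(2)])
      (auto simp: \<Phi>_def)
  have "nonneg_solution \<alpha> f u"
    unfolding nonneg_solution_def
  proof (intro conjI ballI)
    show "has_RL_deriv \<alpha> u (f t (u t)) t" if "t \<in> {0<..<1}" for t
      using u(2) by (intro bvp_sol_has_RL_deriv[OF h(1)[OF u(1)] _ \<sigma>(2) h(2)[OF u(1)] \<alpha> that])
        (use \<sigma> in \<open>auto simp: \<Phi>_def\<close>)
  qed (use u(1) u01 bc du in \<open>auto simp: X_def\<close>)
  moreover have "v t = u t" if v: "nonneg_solution \<alpha> f v" and t: "t \<in> {0..1}" for v t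
  \<comment> \<open>A solution \<open>v\<close> solves the linear problem with right-hand side
    \<open>f s (v s)\<close>, whose only solution is \<open>\<Phi> v\<close>; so \<open>v\<close> is
    a fixed point.\<close>
  proof (rule u_unique[OF _ _ t])
    show vX: "v \<in> X" using v by (simp add: X_def nonneg_solution_def)
    fix s :: real assume s: "s \<in> {0..1}"
    show "\<Phi> v s = v s"
      unfolding \<Phi>_def
      by (rule bvp_sol_unique[OF h(1)[OF vX] _ \<sigma>(2) h(2)[OF vX] \<alpha>, symmetric])
         (use v s \<sigma> in \<open>auto simp: nonneg_solution_def\<close>)
  qed
  moreover have "0 < u t" if t: "t \<in> {0<..<1}" for t
  proof -
    \<comment> \<open>The infinite limit is used at \<open>y = 0\<close> only; monotonicity in
      \<open>y\<close> carries positivity over to \<open>f s (u s)\<close>.\<close>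
    have "\<forall>\<^sub>F s in at_right 0. 0 < f s 0"
      using f_lim[of 0] by (auto simp: filterlim_at_top_dense)
    moreover have "\<forall>\<^sub>F s in at_right 0. s \<in> {0<..<1::real}"
      by (rule eventually_at_right_real) simp
    ultimately have "\<forall>\<^sub>F s in at_right 0. 0 < f s (u s)"
    proof eventually_elim
      case (elim s)
      have us: "0 \<le> u s" using u(1) elim(2) by (auto simp: X_def)
      have "g s 0 \<le> g s (u s)"
        using g_mono[of s] us elim(2) by (auto simp: mono_on_def)
      then have "f s 0 \<le> f s (u s)"
        using f_eq[of s 0] f_eq[of s "u s"] us elim(2) by (auto intro!: mult_right_mono)
      then show ?case using elim(1) by simp
    qed
    then have "0 < bvp_sol \<alpha> (\<lambda>s. f s (u s)) t"
      by (intro bvp_sol_pos[OF h(1)[OF u(1)] \<sigma>(2) \<alpha>(1) t h_nonneg[OF u(1)]])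
    then show ?thesis using u(2)[of t] t by (simp add: \<Phi>_def)
  qed
  ultimately show ?thesis by blast
qed

end
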